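(* Every bipartite graph $G$ with treewidth at most two (and at least one edge and no isolated vertices) is constructible by conditioning. In particular, if $G$ is interpreted as a two-prover question set, then it admits exponential parallel repetition.
   Context: Treewidth: a tree decomposition of a graph $G$ is a tree $T$ whose nodes (buckets) are subsets of $V(G)$ such that for each vertex $v$ the buckets containing $v$ form a nonempty connected subtree, and each edge has both endpoints in some bucket; its width is the maximum bucket size minus one, and $\mathrm{tw}(G)$ is the minimum width. A bipartite graph $(X,Y,E)$ with $E\subseteq X\times Y$ is viewed as a 2-partite hypergraph (and as a two-prover question set $E\subseteq X\times Y$, $Q^{(1)}=X$, $Q^{(2)}=Y$). A homomorphism $(X,Y,E)\to(X',Y',E')$ is a pair of maps $X\to X'$, $Y\to Y'$ mapping edges to edges. For $X_0\subseteq X,Y_0\subseteq Y$ the induced subgraph is $(X_0,Y_0,E\cap(X_0\times Y_0))$. Constructible by conditioning (recursively, up to renaming of vertices): (1) A single edge is constructible. (2) Doubling: given a constructible graph whose vertices are partitioned into "fixed" and "old" vertices, add for every old vertex $q$ a fresh copy $q'$ on the same side, and for every edge $e$ not both of whose endpoints are fixed add the edge $e'$ obtained by replacing each old endpoint by its copy; the result is constructible. (3) Collapse: if $H$ is constructible, $H_0$ is an induced subgraph of $H$, and some homomorphism $H\to H_0$ is the identity on the vertices of $H_0$, then $H_0$ is constructible. Games: a two-prover game with question set $E$ is $(E,A^{(1)}\times A^{(2)},V)$, $V:E\times A^{(1)}\times A^{(2)}\to\{0,1\}$; its value is the maximum over strategies $\mathcal{S}^{(1)}:X\to A^{(1)}$,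 $\mathcal{S}^{(2)}:Y\to A^{(2)}$ of the probability over uniform $(x,y)\in E$ that $V$ accepts $(x,y,\mathcal{S}^{(1)}(x),\mathcal{S}^{(2)}(y))$; trivial if value 1. $\mathcal{G}^n$ has question set $E^n$, answer alphabets $(A^{(j)})^n$, accepts iff all coordinates accept. $\omega_E(n)$ is the supremum of $\mathrm{val}(\mathcal{G}^n)$ over non-trivial games with question set $E$; exponential parallel repetition means $\omega_E(n)\le C^n$ for all $n$ for some $C<1$. *)

theory Defs
  imports "HOL-Probability.Probability_Mass_Function"
begin

section \<open>Bipartite graphs\<close>

text \<open>
  The two sides have separate vertex types, so they are disjoint by construction.
\<close>

record ('a, 'b) bigraph =
  left :: "'a set"
  right :: "'b set"
  edges :: "('a \<times> 'b) set"

definition finite_bigraph :: "('a, 'b) bigraph \<Rightarrow> bool" where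
  "finite_bigraph G \<longleftrightarrow>
     finite (left G) \<and> finite (right G) \<and> edges G \<subseteq> left G \<times> right G"

definition no_isolated_vertices :: "('a, 'b) bigraph \<Rightarrow> bool" where
  "no_isolated_vertices G \<longleftrightarrow>
     (\<forall>x\<in>left G. \<exists>y. (x, y) \<in> edges G) \<and> (\<forall>y\<in>right G. \<exists>x. (x, y) \<in> edges G)"

definition bigraph_hom ::
  "('a, 'b) bigraph \<Rightarrow> ('c, 'd) bigraph \<Rightarrow> ('a \<Rightarrow> 'c) \<Rightarrow> ('b \<Rightarrow> 'd) \<Rightarrow> bool" where
  "bigraph_hom G H f g \<longleftrightarrow>
     f \<in> left G \<rightarrow> left H \<and> g \<in> right G \<rightarrow> right H \<and>
     (\<forall>(x, y)\<in>edges G. (f x, g y) \<in> edges H)"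

definition bigraph_iso :: "('a, 'b) bigraph \<Rightarrow> ('c, 'd) bigraph \<Rightarrow> bool" where
  "bigraph_iso G H \<longleftrightarrow>
     (\<exists>f g. bij_betw f (left G) (left H) \<and> bij_betw g (right G) (right H) \<and>
            edges H = map_prod f g ` edges G)"

definition induced_bigraph :: "('a, 'b) bigraph \<Rightarrow> 'a set \<Rightarrow> 'b set \<Rightarrow> ('a, 'b) bigraph" where
  "induced_bigraph G X\<^sub>0 Y\<^sub>0 =
     \<lparr>left = X\<^sub>0, right = Y\<^sub>0, edges = edges G \<inter> (X\<^sub>0 \<times> Y\<^sub>0)\<rparr>"


section \<open>Constructibility by conditioning\<close>

text \<open>
  \<open>FX\<close> and \<open>FY\<close> are the fixed vertices on the two sides, all other vertices are old;
  \<open>c\<close> and \<open>d\<close> send the old vertices to their fresh copies (their values at fixed vertices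
  are irrelevant).
\<close>

definition double_bigraph ::
  "('a, 'b) bigraph \<Rightarrow> 'a set \<Rightarrow> 'b set \<Rightarrow> ('a \<Rightarrow> 'a) \<Rightarrow> ('b \<Rightarrow> 'b) \<Rightarrow> ('a, 'b) bigraph" where
  "double_bigraph H FX FY c d =
     \<lparr>left = left H \<union> c ` (left H - FX),
      right = right H \<union> d ` (right H - FY),
      edges = edges H \<union>
        {(if x \<in> FX then x else c x, if y \<in> FY then y else d y) | x y.
           (x, y) \<in> edges H \<and> \<not> (x \<in> FX \<and> y \<in> FY)}\<rparr>"

text \<open>
  The recursion needs an unlimited supply of fresh vertices, hence it is carried out on
  vertices of type \<^typ>\<open>nat\<close>; graphs over arbitrary vertex types are then treated up
  to renaming.
\<close>

inductive constructible_nat :: "(nat, nat) bigraph \<Rightarrow> bool" where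
  single_edge: "constructible_nat \<lparr>left = {a}, right = {b}, edges = {(a, b)}\<rparr>"
| doubling:
    "\<lbrakk>constructible_nat H; FX \<subseteq> left H; FY \<subseteq> right H;
      inj_on c (left H - FX); c ` (left H - FX) \<inter> left H = {};
      inj_on d (right H - FY); d ` (right H - FY) \<inter> right H = {}\<rbrakk>
     \<Longrightarrow> constructible_nat (double_bigraph H FX FY c d)"
| collapse:
    "\<lbrakk>constructible_nat H; X\<^sub>0 \<subseteq> left H; Y\<^sub>0 \<subseteq> right H;
      bigraph_hom H (induced_bigraph H X\<^sub>0 Y\<^sub>0) f g;
      \<forall>x\<in>X\<^sub>0. f x = x; \<forall>y\<in>Y\<^sub>0. g y = y\<rbrakk>
     \<Longrightarrow> constructible_nat (induced_bigraph H X\<^sub>0 Y\<^sub>0)"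
| renaming:
    "\<lbrakk>constructible_nat H; bigraph_iso H H'\<rbrakk> \<Longrightarrow> constructible_nat H'"

definition constructible_by_conditioning :: "('a, 'b) bigraph \<Rightarrow> bool" where
  "constructible_by_conditioning G \<longleftrightarrow> (\<exists>H. constructible_nat H \<and> bigraph_iso H G)"


section \<open>Treewidth\<close>

text \<open>
  A simple graph is given by a vertex set \<open>V\<close> and a set \<open>F\<close> of two-element subsets of \<open>V\<close>.
  The tree predicate of the AFP entry Graph-Theory is not used: it only forbids directed
  cycles.
\<close>

definition simple_graph :: "'v set \<Rightarrow> 'v set set \<Rightarrow> bool" where
  "simple_graph V F \<longleftrightarrow> (\<forall>e\<in>F. e \<subseteq> V \<and> card e = 2)"

text \<open>Nonemptiness and connectedness of the subgraph induced by \<open>S\<close>.\<close>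

definition connected_in :: "'v set \<Rightarrow> 'v set set \<Rightarrow> bool" where
  "connected_in S F \<longleftrightarrow>
     S \<noteq> {} \<and> (\<forall>u\<in>S. \<forall>v\<in>S. (u, v) \<in> {(a, b). a \<in> S \<and> b \<in> S \<and> {a, b} \<in> F}\<^sup>*)"

definition is_cycle :: "'v set set \<Rightarrow> 'v list \<Rightarrow> bool" where
  "is_cycle F vs \<longleftrightarrow>
     3 \<le> length vs \<and> distinct vs \<and>
     (\<forall>i<length vs. {vs ! i, vs ! (Suc i mod length vs)} \<in> F)"

definition is_tree :: "'v set \<Rightarrow> 'v set set \<Rightarrow> bool" where
  "is_tree V F \<longleftrightarrow> simple_graph V F \<and> connected_in V F \<and> (\<nexists>vs. is_cycle F vs)"

text \<open>\<open>N\<close> is the set of buckets and \<open>T\<close> the set of edges of the tree.\<close>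

definition tree_decomposition ::
  "'v set \<Rightarrow> 'v set set \<Rightarrow> 'v set set \<Rightarrow> 'v set set set \<Rightarrow> bool" where
  "tree_decomposition V F N T \<longleftrightarrow>
     N \<subseteq> Pow V \<and> is_tree N T \<and>
     (\<forall>v\<in>V. connected_in {B\<in>N. v \<in> B} T) \<and>
     (\<forall>e\<in>F. \<exists>B\<in>N. e \<subseteq> B)"

definition decomposition_width :: "'v set set \<Rightarrow> int" where
  "decomposition_width N = int (Max (card ` N)) - 1"

definition treewidth :: "'v set \<Rightarrow> 'v set set \<Rightarrow> int" where
  "treewidth V F = (LEAST w. \<exists>N T. tree_decomposition V F N T \<and> w = decomposition_width N)"

definition bigraph_treewidth :: "('a, 'b) bigraph \<Rightarrow> int" where
  "bigraph_treewidth G =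
     treewidth (left G <+> right G) ((\<lambda>(x, y). {Inl x, Inr y}) ` edges G)"


section \<open>Two-prover games and parallel repetition\<close>

record ('x, 'y, 'a, 'b) game =
  question_set :: "('x, 'y) bigraph"
  answers1 :: "'a set"
  answers2 :: "'b set"
  accepts :: "'x \<times> 'y \<Rightarrow> 'a \<Rightarrow> 'b \<Rightarrow> bool"

definition finite_game :: "('x, 'y, 'a, 'b) game \<Rightarrow> bool" where
  "finite_game \<G> \<longleftrightarrow>
     finite_bigraph (question_set \<G>) \<and> edges (question_set \<G>) \<noteq> {} \<and>
     finite (answers1 \<G>) \<and> answers1 \<G> \<noteq> {} \<and> finite (answers2 \<G>) \<and> answers2 \<G> \<noteq> {}"

definition winning_prob ::
  "('x, 'y, 'a, 'b) game \<Rightarrow> ('x \<Rightarrow> 'a) \<Rightarrow> ('y \<Rightarrow> 'b) \<Rightarrow> real" where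
  "winning_prob \<G> s t =
     measure_pmf.prob (pmf_of_set (edges (question_set \<G>)))
       {(x, y). accepts \<G> (x, y) (s x) (t y)}"

definition game_value :: "('x, 'y, 'a, 'b) game \<Rightarrow> real" where
  "game_value \<G> =
     Max {winning_prob \<G> s t | s t.
            s \<in> left (question_set \<G>) \<rightarrow>\<^sub>E answers1 \<G> \<and>
            t \<in> right (question_set \<G>) \<rightarrow>\<^sub>E answers2 \<G>}"

definition trivial_game :: "('x, 'y, 'a, 'b) game \<Rightarrow> bool" where
  "trivial_game \<G> \<longleftrightarrow> game_value \<G> = 1"

text \<open>
  Tuples of length \<open>n\<close> are lists of length \<open>n\<close>; an element of \<open>E\<^sup>n\<close> is regarded as a pair of tuples.
\<close>

definition tuples :: "nat \<Rightarrow> 'a set \<Rightarrow> 'a list set" where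
  "tuples n A = {xs. length xs = n \<and> set xs \<subseteq> A}"

definition bigraph_power :: "nat \<Rightarrow> ('x, 'y) bigraph \<Rightarrow> ('x list, 'y list) bigraph" where
  "bigraph_power n Q =
     \<lparr>left = tuples n (left Q), right = tuples n (right Q),
      edges = {(xs, ys). length xs = n \<and> length ys = n \<and>
                         (\<forall>i<n. (xs ! i, ys ! i) \<in> edges Q)}\<rparr>"

definition parallel_repetition ::
  "nat \<Rightarrow> ('x, 'y, 'a, 'b) game \<Rightarrow> ('x list, 'y list, 'a list, 'b list) game" where
  "parallel_repetition n \<G> =
     \<lparr>question_set = bigraph_power n (question_set \<G>),
      answers1 = tuples n (answers1 \<G>), answers2 = tuples n (answers2 \<G>),
      accepts = (\<lambda>(xs, ys) as bs. \<forall>i<n. accepts \<G> (xs ! i, ys ! i) (as ! i) (bs ! i))\<rparr>"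

text \<open>
  Answer alphabets range over the finite nonempty sets of natural numbers, which represent all
  finite nonempty alphabets up to renaming of answers.
\<close>

definition repetition_value :: "('x, 'y) bigraph \<Rightarrow> nat \<Rightarrow> real" where
  "repetition_value Q n =
     Sup {game_value (parallel_repetition n \<G>) | \<G> :: ('x, 'y, nat, nat) game.
            finite_game \<G> \<and> question_set \<G> = Q \<and> \<not> trivial_game \<G>}"

definition exponential_parallel_repetition :: "('x, 'y) bigraph \<Rightarrow> bool" where
  "exponential_parallel_repetition Q \<longleftrightarrow> (\<exists>C<1. \<forall>n. repetition_value Q n \<le> C ^ n)"

end

theory Submission
  imports Defs
begin

text \<open>
  Constructibility: we may treat components separately. A connected graph \<open>G\<close> of treewidth at
  most two is a retract of the graph obtained
  from its chordal completion (a 2-tree) by replacing each edge \<open>ab\<close> by a path of length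
  \<open>d\<^sub>G(a, b)\<close>. The latter graph is built by adding ears: a new vertex \<open>v\<close> with neighbours \<open>a, b\<close> in the
  2-tree requires an ear of length \<open>d\<^sub>G(a, v) + d\<^sub>G(v, b) = d\<^sub>G(a, b) + 2k\<close>, which is found in a doubling
  after attaching a pendant walk of length \<open>k\<close> at \<open>a\<close> and fixing its end and \<open>b\<close>. Instead of
  these graphs it suffices to carry along some constructible \<open>M\<close> with a homomorphism to \<open>G\<close> and a
  section in which the required walks exist.

  Parallel repetition: following the construction of \<open>H\<close> one samples a random homomorphism from \<open>H\<close> to
  \<open>Q\<close>, a doubling being sampled as two conditionally independent copies. By Cauchy--Schwarz the
  \<open>n\<close>-fold product maps \<open>H\<close> into a set of density \<open>\<mu>\<close> with probability at least \<open>\<mu>\<^sup>K\<close>. For \<open>H \<cong> Q\<close>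
  the isomorphism has a positive probability \<open>p\<close>, so if \<open>\<mu>\<^sup>K > (1 - p)\<^sup>n\<close> then the winning set contains a
  copy of \<open>Q\<close> that is the identity in some coordinate, and this coordinate wins the original game
  perfectly.
\<close>

section \<open>Constructible graphs and homomorphisms\<close>

text \<open>Structural induction. In the collapse case the retraction sends an edge at a kept vertex
  to an edge at the same vertex with both ends kept, so no kept vertex becomes isolated. Finiteness
  later provides fresh names, and the absence of isolated vertices provides neighbours.\<close>

lemma constructible_nat_wf:
  assumes "constructible_nat H"
  shows "finite_bigraph H \<and> edges H \<noteq> {} \<and> no_isolated_vertices H"
  using assms
proof (induction rule: constructible_nat.induct)
  case (single_edge a b)
  then show ?case by (auto simp: finite_bigraph_def no_isolated_vertices_def)
next
  case (doubling H FX FY c d)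
  have fin: "finite (left H)" "finite (right H)" and E: "edges H \<subseteq> left H \<times> right H"
    using doubling.IH by (auto simp: finite_bigraph_def)
  have "\<exists>y. (x, y) \<in> edges (double_bigraph H FX FY c d)" if x: "x \<in> left (double_bigraph H FX FY c d)" for x
  proof (cases "x \<in> left H")
    case True
    then show ?thesis using doubling.IH unfolding no_isolated_vertices_def double_bigraph_def by fastforce
  next
    case False
    then obtain x' where x': "x' \<in> left H" "x' \<notin> FX" "x = c x'"
      using x by (auto simp: double_bigraph_def)
    then obtain y where "(x', y) \<in> edges H"
      using doubling.IH unfolding no_isolated_vertices_def by blast
    then have "(c x', if y \<in> FY then y else d y) \<in> edges (double_bigraph H FX FY c d)"
      using x' unfolding double_bigraph_def by auto
    then show ?thesis using x' by blast
  qed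
  moreover have "\<exists>x. (x, y) \<in> edges (double_bigraph H FX FY c d)" if y: "y \<in> right (double_bigraph H FX FY c d)" for y
  proof (cases "y \<in> right H")
    case True
    then show ?thesis using doubling.IH unfolding no_isolated_vertices_def double_bigraph_def by fastforce
  next
    case False
    then obtain y' where y': "y' \<in> right H" "y' \<notin> FY" "y = d y'"
      using y by (auto simp: double_bigraph_def)
    then obtain x where "(x, y') \<in> edges H"
      using doubling.IH unfolding no_isolated_vertices_def by blast
    then have "(if x \<in> FX then x else c x, d y') \<in> edges (double_bigraph H FX FY c d)"
      using y' unfolding double_bigraph_def by auto
    then show ?thesis using y' by blast
  qed
  moreover have "finite_bigraph (double_bigraph H FX FY c d)"
    using fin E by (fastforce simp: finite_bigraph_def double_bigraph_def)
  moreover have "edges (double_bigraph H FX FY c d) \<noteq> {}"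
    using doubling.IH by (auto simp: double_bigraph_def)
  ultimately show ?case by (auto simp: no_isolated_vertices_def)
next
  case (collapse H X\<^sub>0 Y\<^sub>0 f g)
  have E: "(f x, g y) \<in> edges H \<inter> (X\<^sub>0 \<times> Y\<^sub>0)" if "(x, y) \<in> edges H" for x y
    using collapse.hyps that unfolding bigraph_hom_def induced_bigraph_def by fastforce
  have "finite X\<^sub>0" "finite Y\<^sub>0"
    using collapse.IH collapse.hyps(2,3) finite_subset unfolding finite_bigraph_def by blast+
  moreover have "\<exists>y. (x, y) \<in> edges H \<inter> (X\<^sub>0 \<times> Y\<^sub>0)" if x: "x \<in> X\<^sub>0" for x
    using collapse.IH collapse.hyps x E unfolding no_isolated_vertices_def by (metis subsetD)
  moreover have "\<exists>x. (x, y) \<in> edges H \<inter> (X\<^sub>0 \<times> Y\<^sub>0)" if y: "y \<in> Y\<^sub>0" for y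
    using collapse.IH collapse.hyps y E unfolding no_isolated_vertices_def by (metis subsetD)
  moreover have "edges H \<inter> (X\<^sub>0 \<times> Y\<^sub>0) \<noteq> {}"
    using collapse.IH E by fastforce
  ultimately show ?case
    by (auto simp: finite_bigraph_def induced_bigraph_def no_isolated_vertices_def)
next
  case (renaming H H')
  then obtain f g where fg: "bij_betw f (left H) (left H')" "bij_betw g (right H) (right H')"
    "edges H' = map_prod f g ` edges H" unfolding bigraph_iso_def by blast
  have im: "f ` left H = left H'" "g ` right H = right H'"
    using fg by (auto simp: bij_betw_def)
  have "\<exists>y. (x, y) \<in> edges H'" if x: "x \<in> left H'" for x
  proof -
    obtain x' where x': "x' \<in> left H" "x = f x'" using x im by blast
    then obtain y where "(x', y) \<in> edges H" using renaming.IH unfolding no_isolated_vertices_def by blast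
    then have "(x, g y) \<in> edges H'" unfolding fg x' by force
    then show ?thesis by blast
  qed
  moreover have "\<exists>x. (x, y) \<in> edges H'" if y: "y \<in> right H'" for y
  proof -
    obtain y' where y': "y' \<in> right H" "y = g y'" using y im by blast
    then obtain x where "(x, y') \<in> edges H" using renaming.IH unfolding no_isolated_vertices_def by blast
    then have "(f x, y) \<in> edges H'" unfolding fg y' by force
    then show ?thesis by blast
  qed
  moreover have "finite_bigraph H'"
    using renaming.IH unfolding finite_bigraph_def fg(3) im[symmetric] by auto
  ultimately show ?case using renaming.IH fg by (auto simp: no_isolated_vertices_def)
qed

section \<open>Walks and homomorphisms on the union of the two sides\<close>

definition verts :: "('a, 'b) bigraph \<Rightarrow> ('a + 'b) set" where
  "verts H = left H <+> right H"

text \<open>The two sides are merged into a sum type so that a walk of length \<open>n\<close> is a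
  pair in \<open>adj H ^^ n\<close> and \<open>isl\<close> tells the side of a vertex.\<close>

definition adj :: "('a, 'b) bigraph \<Rightarrow> (('a + 'b) \<times> ('a + 'b)) set" where
  "adj H = {(Inl x, Inr y) | x y. (x, y) \<in> edges H} \<union> {(Inr y, Inl x) | x y. (x, y) \<in> edges H}"

text \<open>Preservation of adjacency alone would allow the two sides of a component to be
  exchanged; the condition on \<open>isl\<close> excludes this.\<close>

definition hom :: "('a, 'b) bigraph \<Rightarrow> ('c, 'd) bigraph \<Rightarrow> ('a + 'b \<Rightarrow> 'c + 'd) \<Rightarrow> bool" where
  "hom H G h \<longleftrightarrow> (\<forall>(u, v)\<in>adj H. (h u, h v) \<in> adj G) \<and>
     (\<forall>v\<in>verts H. h v \<in> verts G \<and> isl (h v) = isl v)"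

lemma Inl_verts [simp]: "Inl x \<in> verts H \<longleftrightarrow> x \<in> left H"
  and Inr_verts [simp]: "Inr y \<in> verts H \<longleftrightarrow> y \<in> right H"
  by (auto simp: verts_def)

lemma adj_simps [simp]:
  "(Inl x, Inr y) \<in> adj H \<longleftrightarrow> (x, y) \<in> edges H" "(Inr y, Inl x) \<in> adj H \<longleftrightarrow> (x, y) \<in> edges H"
  "(Inl x, Inl x') \<notin> adj H" "(Inr y, Inr y') \<notin> adj H"
  by (auto simp: adj_def)

lemma adj_sym: "(u, v) \<in> adj H \<Longrightarrow> (v, u) \<in> adj H"
  by (auto simp: adj_def)

lemma adj_isl: "(u, v) \<in> adj H \<Longrightarrow> isl v \<longleftrightarrow> \<not> isl u"
  by (auto simp: adj_def)

lemma adj_verts: "finite_bigraph H \<Longrightarrow> (u, v) \<in> adj H \<Longrightarrow> u \<in> verts H \<and> v \<in> verts H"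
  by (auto simp: adj_def finite_bigraph_def)

lemma ex_adj: "no_isolated_vertices H \<Longrightarrow> v \<in> verts H \<Longrightarrow> \<exists>u. (v, u) \<in> adj H"
  unfolding no_isolated_vertices_def by (cases v) (auto simp: adj_def)

lemma hom_adj: "hom H G h \<Longrightarrow> (u, v) \<in> adj H \<Longrightarrow> (h u, h v) \<in> adj G"
  by (auto simp: hom_def)

lemma hom_verts: "hom H G h \<Longrightarrow> v \<in> verts H \<Longrightarrow> h v \<in> verts G"
  by (auto simp: hom_def)

lemma hom_isl: "hom H G h \<Longrightarrow> v \<in> verts H \<Longrightarrow> isl (h v) = isl v"
  by (auto simp: hom_def)

lemma relpow_map:
  assumes "\<And>u v. (u, v) \<in> R \<Longrightarrow> (h u, h v) \<in> S"
  shows "(u, v) \<in> R ^^ n \<Longrightarrow> (h u, h v) \<in> S ^^ n"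
  by (induction n arbitrary: v) (auto intro: assms)

lemma hom_relpow: "hom H G h \<Longrightarrow> (u, v) \<in> adj H ^^ n \<Longrightarrow> (h u, h v) \<in> adj G ^^ n"
  by (rule relpow_map) (auto intro: hom_adj)

lemma adj_relpow_sym: "(u, v) \<in> adj H ^^ n \<Longrightarrow> (v, u) \<in> adj H ^^ n"
proof (induction n arbitrary: v)
  case (Suc n)
  then obtain w where "(u, w) \<in> adj H ^^ n" "(w, v) \<in> adj H" by auto
  then show ?case using Suc.IH adj_sym relpow_Suc_I2 by metis
qed auto

text \<open>Every step changes sides. This parity constraint later makes the excess of a detour over
  a geodesic even.\<close>

lemma adj_relpow_isl: "(u, v) \<in> adj H ^^ n \<Longrightarrow> (isl v \<longleftrightarrow> (isl u \<longleftrightarrow> even n))"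
proof (induction n arbitrary: v)
  case (Suc n)
  then show ?case using adj_isl by (fastforce dest: adj_isl)
qed auto

lemma adj_relpow_verts: "finite_bigraph H \<Longrightarrow> (u, v) \<in> adj H ^^ n \<Longrightarrow> u \<in> verts H \<Longrightarrow> v \<in> verts H"
  by (induction n arbitrary: v) (auto dest: adj_verts)

text \<open>The map \<open>\<iota> \<circ> \<rho>\<close> retracts \<open>M\<close> onto the image
  of \<iota>, so collapse applies to the subgraph induced there. That subgraph is a copy of
  \<open>G\<close>: it has no surplus edges, because \<rho> maps each of its edges back to an edge
  of \<open>G\<close>.\<close>

lemma retract_constructible:
  assumes M: "constructible_nat M" and \<rho>: "hom M G \<rho>"
    and \<iota>: "\<And>v. v \<in> verts G \<Longrightarrow> \<iota> v \<in> verts M \<and> \<rho> (\<iota> v) = v"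
    and adj: "\<And>u v. (u, v) \<in> adj G \<Longrightarrow> (\<iota> u, \<iota> v) \<in> adj M"
    and G: "finite_bigraph G"
  shows "constructible_by_conditioning G"
proof -
  define f where "f x = projl (\<iota> (Inl x))" for x
  define g where "g y = projr (\<iota> (Inr y))" for y
  define p where "p n = projl (\<rho> (Inl n))" for n
  define q where "q n = projr (\<rho> (Inr n))" for n
  have isl: "isl (\<iota> v) = isl v" if "v \<in> verts G" for v
    using hom_isl[OF \<rho>, of "\<iota> v"] \<iota>[OF that] by simp
  have f: "\<iota> (Inl x) = Inl (f x)" if "x \<in> left G" for x
    using isl[of "Inl x"] that by (simp add: f_def)
  have g: "\<iota> (Inr y) = Inr (g y)" if "y \<in> right G" for y
    using isl[of "Inr y"] that by (simp add: g_def)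
  have p: "\<rho> (Inl n) = Inl (p n)" if "n \<in> left M" for n
    using hom_isl[OF \<rho>, of "Inl n"] that by (simp add: p_def)
  have q: "\<rho> (Inr n) = Inr (q n)" if "n \<in> right M" for n
    using hom_isl[OF \<rho>, of "Inr n"] that by (simp add: q_def)
  have f': "f x \<in> left M" "p (f x) = x" if "x \<in> left G" for x
    using \<iota>[of "Inl x"] f[OF that] that p[of "f x"] by auto
  have g': "g y \<in> right M" "q (g y) = y" if "y \<in> right G" for y
    using \<iota>[of "Inr y"] g[OF that] that q[of "g y"] by auto
  have p': "p n \<in> left G" if "n \<in> left M" for n
    using hom_verts[OF \<rho>, of "Inl n"] p that by auto
  have q': "q n \<in> right G" if "n \<in> right M" for n
    using hom_verts[OF \<rho>, of "Inr n"] q that by auto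
  have EM: "edges M \<subseteq> left M \<times> right M"
    using constructible_nat_wf[OF M] by (auto simp: finite_bigraph_def)
  have EG: "edges G \<subseteq> left G \<times> right G" using G by (auto simp: finite_bigraph_def)
  have pq: "(p n, q m) \<in> edges G" if "(n, m) \<in> edges M" for n m
    using hom_adj[OF \<rho>, of "Inl n" "Inr m"] that EM p q by auto
  have fg: "(f x, g y) \<in> edges M" if "(x, y) \<in> edges G" for x y
    using adj[of "Inl x" "Inr y"] that EG f g by auto
  let ?H = "induced_bigraph M (f ` left G) (g ` right G)"
  have "constructible_nat ?H"
  proof (rule constructible_nat.collapse[OF M])
    show "bigraph_hom M ?H (f \<circ> p) (g \<circ> q)"
      unfolding bigraph_hom_def induced_bigraph_def
      using p' q' pq fg EG by fastforce
  qed (use f' g' in auto)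
  moreover have "bigraph_iso ?H G"
    unfolding bigraph_iso_def
  proof (intro exI conjI)
    show "bij_betw p (left ?H) (left G)"
      by (rule bij_betw_byWitness[where f' = f]) (auto simp: induced_bigraph_def f')
    show "bij_betw q (right ?H) (right G)"
      by (rule bij_betw_byWitness[where f' = g]) (auto simp: induced_bigraph_def g')
    show "edges G = map_prod p q ` edges ?H"
    proof
      show "edges G \<subseteq> map_prod p q ` edges ?H"
      proof
        fix e assume e: "e \<in> edges G"
        then obtain x y where xy: "e = (x, y)" "x \<in> left G" "y \<in> right G" using EG by blast
        then have "e = map_prod p q (f x, g y)" "(f x, g y) \<in> edges ?H"
          using fg e f' g' by (auto simp: induced_bigraph_def)
        then show "e \<in> map_prod p q ` edges ?H" by blast
      qed
      show "map_prod p q ` edges ?H \<subseteq> edges G"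
        using pq by (auto simp: induced_bigraph_def)
    qed
  qed
  ultimately show ?thesis unfolding constructible_by_conditioning_def by blast
qed

text \<open>\<open>H'\<close> is the pushout of two copies of \<open>H\<close> along \<open>F\<close>.\<close>

lemma doubling_pushout:
  fixes G :: "('a, 'b) bigraph"
  assumes H: "constructible_nat H"
  obtains H' j where "constructible_nat H'" "hom H H' id" "hom H H' j" "\<And>v. v \<in> F \<Longrightarrow> v \<in> verts H \<Longrightarrow> j v = v"
    "\<And>h\<^sub>1 h\<^sub>2. hom H G h\<^sub>1 \<Longrightarrow> hom H G h\<^sub>2 \<Longrightarrow> (\<And>v. v \<in> F \<Longrightarrow> v \<in> verts H \<Longrightarrow> h\<^sub>1 v = h\<^sub>2 v) \<Longrightarrow>
       \<exists>h. hom H' G h \<and> (\<forall>v\<in>verts H. h v = h\<^sub>1 v \<and> h (j v) = h\<^sub>2 v)"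
proof -
  have fin: "finite (left H)" "finite (right H)" and E: "edges H \<subseteq> left H \<times> right H"
    using constructible_nat_wf[OF H] by (auto simp: finite_bigraph_def)
  obtain N where N: "\<And>n. n \<in> left H \<union> right H \<Longrightarrow> n < N"
    using finite_nat_set_iff_bounded[of "left H \<union> right H"] fin by auto
  \<comment> \<open>Shifting by a strict bound of all vertices makes the copies fresh, and the
    copying map is undone by subtracting \<open>N\<close>.\<close>
  define c where "c n = n + N" for n :: nat
  have c: "c n \<notin> left H" "c n \<notin> right H" for n
    using N[of "c n"] by (auto simp: c_def)
  have inj: "inj_on c A" for A by (auto simp: c_def inj_on_def)
  define FX where "FX = {x\<in>left H. Inl x \<in> F}"
  define FY where "FY = {y\<in>right H. Inr y \<in> F}"
  define H' where "H' = double_bigraph H FX FY c c"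
  define j where "j = map_sum (\<lambda>x. if x \<in> FX then x else c x) (\<lambda>y. if y \<in> FY then y else c y)"
  have left: "left H' = left H \<union> c ` (left H - FX)" and right: "right H' = right H \<union> c ` (right H - FY)"
    and edges: "edges H' = edges H \<union> {(if x \<in> FX then x else c x, if y \<in> FY then y else c y) | x y.
           (x, y) \<in> edges H \<and> \<not> (x \<in> FX \<and> y \<in> FY)}"
    by (simp_all add: H'_def double_bigraph_def)
  have 1: "constructible_nat H'"
    unfolding H'_def by (rule constructible_nat.doubling[OF H]) (use c inj in \<open>auto simp: FX_def FY_def\<close>)
  have 2: "hom H H' id"
    by (auto simp: hom_def adj_def edges verts_def left right)
  have 3: "hom H H' j"
  proof -
    have "j v \<in> verts H' \<and> isl (j v) = isl v" if "v \<in> verts H" for v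
      using that by (cases v) (auto simp: j_def left right)
    moreover have *: "(j (Inl x), j (Inr y)) \<in> adj H'" if "(x, y) \<in> edges H" for x y
      using that by (auto simp: j_def edges)
    moreover have "(j u, j v) \<in> adj H'" if "(u, v) \<in> adj H" for u v
      using that *[of "projl u" "projr v"] adj_sym[OF *[of "projl v" "projr u"]] by (auto simp: adj_def[of H])
    ultimately show ?thesis unfolding hom_def by auto
  qed
  have 4: "j v = v" if "v \<in> F" "v \<in> verts H" for v
    using that by (cases v) (auto simp: j_def FX_def FY_def)
  have 5: "\<exists>h. hom H' G h \<and> (\<forall>v\<in>verts H. h v = h\<^sub>1 v \<and> h (j v) = h\<^sub>2 v)"
    if h1: "hom H G h\<^sub>1" and h2: "hom H G h\<^sub>2" and eq: "\<And>v. v \<in> F \<Longrightarrow> v \<in> verts H \<Longrightarrow> h\<^sub>1 v = h\<^sub>2 v" for h\<^sub>1 h\<^sub>2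
  proof -
    \<comment> \<open>A vertex of \<open>H'\<close> outside \<open>H\<close> is a copy, which is
      sent where \<open>h\<^sub>2\<close> sends its original. At fixed vertices, which lie in
      \<open>H\<close>, the hypothesis \<open>eq\<close> reconciles the two maps.\<close>
    define h where "h v = (if v \<in> verts H then h\<^sub>1 v else h\<^sub>2 (map_sum (\<lambda>x. x - N) (\<lambda>y. y - N) v))" for v
    have h: "h v = h\<^sub>1 v" "h (j v) = h\<^sub>2 v" if "v \<in> verts H" for v
    proof -
      show "h v = h\<^sub>1 v" using that by (simp add: h_def)
      show "h (j v) = h\<^sub>2 v"
      proof (cases v)
        case (Inl x)
        then show ?thesis using that eq[of v] c by (auto simp: h_def j_def FX_def c_def)
      next
        case (Inr y)
        then show ?thesis using that eq[of v] c by (auto simp: h_def j_def FY_def c_def)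
      qed
    qed
    have hj: "v \<in> verts H \<or> (\<exists>u\<in>verts H. v = j u)" if v: "v \<in> verts H'" for v
    proof (cases v)
      case (Inl x)
      then consider "x \<in> left H" | x' where "x' \<in> left H" "x' \<notin> FX" "x = c x'"
        using v by (auto simp: left)
      then show ?thesis
      proof cases
        case 2
        then have "Inl x' \<in> verts H" "v = j (Inl x')" using Inl by (auto simp: j_def)
        then show ?thesis by blast
      qed (simp add: Inl)
    next
      case (Inr y)
      then consider "y \<in> right H" | y' where "y' \<in> right H" "y' \<notin> FY" "y = c y'"
        using v by (auto simp: right)
      then show ?thesis
      proof cases
        case 2
        then have "Inr y' \<in> verts H" "v = j (Inr y')" using Inr by (auto simp: j_def)
        then show ?thesis by blast
      qed (simp add: Inr)
    qed
    have isl_j: "isl (j v) = isl v" for v by (cases v) (auto simp: j_def)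
    have adj: "(u, v) \<in> adj H \<or> (\<exists>u' v'. (u', v') \<in> adj H \<and> u = j u' \<and> v = j v')" if "(u, v) \<in> adj H'" for u v
    proof -
      have *: "(x, y) \<in> edges H \<or> (\<exists>x' y'. (x', y') \<in> edges H \<and> Inl x = j (Inl x') \<and> Inr y = j (Inr y'))"
        if "(x, y) \<in> edges H'" for x y
      proof -
        have "(x, y) \<in> edges H \<or> (\<exists>x' y'. (x', y') \<in> edges H \<and>
            x = (if x' \<in> FX then x' else c x') \<and> y = (if y' \<in> FY then y' else c y'))"
          using that unfolding edges by blast
        then show ?thesis by (simp add: j_def)
      qed
      show ?thesis
      proof (cases u)
        case (Inl x)
        then obtain y where y: "v = Inr y" "(x, y) \<in> edges H'" using \<open>(u, v) \<in> adj H'\<close> by (cases v) auto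
        from *[OF y(2)] show ?thesis
        proof
          assume "\<exists>x' y'. (x', y') \<in> edges H \<and> Inl x = j (Inl x') \<and> Inr y = j (Inr y')"
          then obtain x' y' where "(Inl x', Inr y') \<in> adj H" "u = j (Inl x')" "v = j (Inr y')"
            using Inl y(1) by auto
          then show ?thesis by blast
        qed (simp add: Inl y)
      next
        case (Inr y)
        then obtain x where x: "v = Inl x" "(x, y) \<in> edges H'" using \<open>(u, v) \<in> adj H'\<close> by (cases v) auto
        from *[OF x(2)] show ?thesis
        proof
          assume "\<exists>x' y'. (x', y') \<in> edges H \<and> Inl x = j (Inl x') \<and> Inr y = j (Inr y')"
          then obtain x' y' where "(Inr y', Inl x') \<in> adj H" "u = j (Inr y')" "v = j (Inl x')"
            using Inr x(1) by auto
          then show ?thesis by blast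
        qed (simp add: Inr x)
      qed
    qed
    have fb: "finite_bigraph H" using constructible_nat_wf[OF H] by simp
    have "h v \<in> verts G \<and> isl (h v) = isl v" if "v \<in> verts H'" for v
      using hj[OF that]
    proof
      assume "v \<in> verts H"
      then show ?thesis using h(1) hom_verts[OF h1] hom_isl[OF h1] by simp
    next
      assume "\<exists>u\<in>verts H. v = j u"
      then show ?thesis using h(2) hom_verts[OF h2] hom_isl[OF h2] isl_j by auto
    qed
    moreover have "(h u, h v) \<in> adj G" if "(u, v) \<in> adj H'" for u v
      using adj[OF that]
    proof
      assume *: "(u, v) \<in> adj H"
      then show ?thesis using h(1) hom_adj[OF h1 *] adj_verts[OF fb *] by simp
    next
      assume "\<exists>u' v'. (u', v') \<in> adj H \<and> u = j u' \<and> v = j v'"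
      then obtain u' v' where *: "(u', v') \<in> adj H" and "u = j u'" "v = j v'" by blast
      then show ?thesis using h(2) hom_adj[OF h2 *] adj_verts[OF fb *] by simp
    qed
    ultimately have "hom H' G h" unfolding hom_def by auto
    then show ?thesis using h by blast
  qed
  show ?thesis by (rule that[OF 1 2 3 4 5])
qed

section \<open>Attaching a vertex along geodesics\<close>

text \<open>The graph distance. Its value is unspecified for vertices in different components, hence
  the reachability conditions \<open>(u, v) \<in> (adj G)\<^sup>*\<close> below.\<close>

definition gdist :: "('a, 'b) bigraph \<Rightarrow> 'a + 'b \<Rightarrow> 'a + 'b \<Rightarrow> nat" where
  "gdist G u v = (LEAST n. (u, v) \<in> adj G ^^ n)"

lemma gdist_walk: "(u, v) \<in> (adj G)\<^sup>* \<Longrightarrow> (u, v) \<in> adj G ^^ gdist G u v"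
  unfolding gdist_def by (metis LeastI rtrancl_imp_relpow)

lemma gdist_le: "(u, v) \<in> adj G ^^ n \<Longrightarrow> gdist G u v \<le> n"
  unfolding gdist_def by (rule Least_le)

lemma gdist_commute: "gdist G u v = gdist G v u"
  unfolding gdist_def by (metis adj_relpow_sym)

lemma gdist_self [simp]: "gdist G u u = 0"
proof -
  have "(u, u) \<in> adj G ^^ 0" by simp
  from gdist_le[OF this] show ?thesis by simp
qed

lemma adj_rtrancl_sym: "(u, v) \<in> (adj G)\<^sup>* \<Longrightarrow> (v, u) \<in> (adj G)\<^sup>*"
  by (metis adj_relpow_sym rtrancl_power)

section \<open>Walks and homomorphisms along walks\<close>

lemma relpow_segment:
  assumes "\<And>i. i < n \<Longrightarrow> (f (s + i), f (s + Suc i)) \<in> R"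
  shows "(f s, f (s + n)) \<in> R ^^ n"
  unfolding relpow_fun_conv by (rule exI[of _ "\<lambda>i. f (s + i)"]) (use assms in auto)

text \<open>Past its end the walk goes back and forth along one edge at \<open>v\<close>. An
  infinite walk is wanted as the target for folding a whole component, whose vertices may lie at
  distances beyond the end of the given walk.\<close>

lemma extend_walk:
  assumes G: "finite_bigraph G" "no_isolated_vertices G" and u: "u \<in> verts G"
    and walk: "(u, v) \<in> adj G ^^ n"
  obtains f where "f 0 = u" "f n = v" "\<And>i. (f i, f (Suc i)) \<in> adj G"
proof -
  obtain g where g: "g 0 = u" "g n = v" "\<And>i. i < n \<Longrightarrow> (g i, g (Suc i)) \<in> adj G"
    using walk unfolding relpow_fun_conv by blast
  obtain c where c: "(v, c) \<in> adj G"
    using ex_adj[OF G(2)] adj_relpow_verts[OF G(1) walk u] by blast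
  define f where "f i = (if i \<le> n then g i else if even (i - n) then v else c)" for i
  have "(f i, f (Suc i)) \<in> adj G" for i
  proof (cases "i \<le> n")
    case True
    then show ?thesis using g c by (cases "i = n") (auto simp: f_def)
  next
    case False
    then show ?thesis using c adj_sym[OF c] by (auto simp: f_def Suc_diff_le)
  qed
  then show ?thesis using that[of f] g by (auto simp: f_def)
qed

text \<open>Folding by sides disposes of a second copy of \<open>M\<close> in which only a vertex or
  an edge matters.\<close>

lemma hom_fold:
  assumes "finite_bigraph G" "(v, u) \<in> adj G"
  shows "hom M G (\<lambda>m. if isl m \<longleftrightarrow> isl v then v else u)"
  using adj_verts[OF assms] adj_isl[OF assms(2)] assms(2) adj_sym[OF assms(2)]
  unfolding hom_def by (auto dest: adj_isl)

lemma hom_comp: "hom H H' f \<Longrightarrow> hom H' H'' g \<Longrightarrow> hom H H'' (g \<circ> f)"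
  unfolding hom_def by fastforce

text \<open>Doubling with only \<open>a\<close> fixed glues a second copy of \<open>M\<close> at
  \<open>a\<close>. Since that copy can be folded onto the edge between \<open>\<rho> a\<close> and
  \<open>g\<close>, the copy of a neighbour of \<open>a\<close> behaves like the end of a pendant
  edge.\<close>

lemma pendant_edge:
  fixes G :: "('a, 'b) bigraph"
  assumes M: "constructible_nat M" and a: "a \<in> verts M" and G: "finite_bigraph G"
  obtains M' w where "constructible_nat M'" "hom M M' id" "(a, w) \<in> adj M'"
    "\<And>\<rho> g. hom M G \<rho> \<Longrightarrow> (\<rho> a, g) \<in> adj G \<Longrightarrow> \<exists>h. hom M' G h \<and> (\<forall>v\<in>verts M. h v = \<rho> v) \<and> h w = g"
proof -
  have wf: "finite_bigraph M" "no_isolated_vertices M" using constructible_nat_wf[OF M] by auto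
  obtain n where n: "(a, n) \<in> adj M" using ex_adj[OF wf(2) a] by blast
  obtain M' j where M': "constructible_nat M'" "hom M M' id" and j: "hom M M' j"
    "\<And>v. v \<in> {a} \<Longrightarrow> v \<in> verts M \<Longrightarrow> j v = v"
    and univ: "\<And>h\<^sub>1 h\<^sub>2. hom M G h\<^sub>1 \<Longrightarrow> hom M G h\<^sub>2 \<Longrightarrow> (\<And>v. v \<in> {a} \<Longrightarrow> v \<in> verts M \<Longrightarrow> h\<^sub>1 v = h\<^sub>2 v) \<Longrightarrow>
       \<exists>h. hom M' G h \<and> (\<forall>v\<in>verts M. h v = h\<^sub>1 v \<and> h (j v) = h\<^sub>2 v)"
    by (rule doubling_pushout[OF M, where F = "{a}" and 'a = 'a and 'b = 'b]) blast
  have w: "(a, j n) \<in> adj M'" using hom_adj[OF j(1) n] j(2) a by simp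
  have "\<exists>h. hom M' G h \<and> (\<forall>v\<in>verts M. h v = \<rho> v) \<and> h (j n) = g"
    if \<rho>: "hom M G \<rho>" and g: "(\<rho> a, g) \<in> adj G" for \<rho> g
  proof -
    obtain h where h: "hom M' G h"
      "\<forall>v\<in>verts M. h v = \<rho> v \<and> h (j v) = (if isl v \<longleftrightarrow> isl (\<rho> a) then \<rho> a else g)"
      using univ[OF \<rho> hom_fold[OF G g]] hom_isl[OF \<rho> a] by auto
    then have "h (j n) = g"
      using adj_isl[OF n] adj_verts[OF wf(1) n] hom_isl[OF \<rho> a] by auto
    then show ?thesis using h by blast
  qed
  from that[OF M' w this] show ?thesis .
qed

text \<open>Pendant edges are added one after the other at the current end of the walk. The
  extension property quantifies over all \<rho> and \<open>q\<close> because it will be applied to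
  two homomorphisms of \<open>M\<close>, with different walks.\<close>

lemma pendant_walk:
  fixes G :: "('a, 'b) bigraph"
  assumes M: "constructible_nat M" and a: "a \<in> verts M" and G: "finite_bigraph G"
  shows "\<exists>M' p. constructible_nat M' \<and> hom M M' id \<and> p 0 = a \<and> (\<forall>i<k. (p i, p (Suc i)) \<in> adj M') \<and>
    (\<forall>\<rho> q. hom M G \<rho> \<and> q 0 = \<rho> a \<and> (\<forall>i<k. (q i, q (Suc i)) \<in> adj G) \<longrightarrow>
      (\<exists>h. hom M' G h \<and> (\<forall>v\<in>verts M. h v = \<rho> v) \<and> (\<forall>i\<le>k. h (p i) = q i)))"
proof (induction k)
  case 0
  have "hom M M (\<lambda>v. v)" by (auto simp: hom_def)
  then show ?case using M a by (intro exI[of _ M] exI[of _ "\<lambda>_. a"]) (auto simp: id_def)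
next
  case (Suc k)
  then obtain M' p where M': "constructible_nat M'" "hom M M' id" and p: "p 0 = a"
    "\<And>i. i < k \<Longrightarrow> (p i, p (Suc i)) \<in> adj M'"
    and univ: "\<And>\<rho> q. hom M G \<rho> \<Longrightarrow> q 0 = \<rho> a \<Longrightarrow> (\<forall>i<k. (q i, q (Suc i)) \<in> adj G) \<Longrightarrow>
      (\<exists>h. hom M' G h \<and> (\<forall>v\<in>verts M. h v = \<rho> v) \<and> (\<forall>i\<le>k. h (p i) = q i))"
    by blast
  have fM': "finite_bigraph M'" using constructible_nat_wf[OF M'(1)] by simp
  have pv: "p i \<in> verts M'" if "i \<le> k" for i
    using that
  proof (induction i)
    case 0
    then show ?case using hom_verts[OF M'(2) a] p by simp
  next
    case (Suc i)
    then show ?case using p(2)[of i] adj_verts[OF fM'] by auto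
  qed
  obtain M'' w where M'': "constructible_nat M''" "hom M' M'' id" "(p k, w) \<in> adj M''"
    and univ': "\<And>\<rho> g. hom M' G \<rho> \<Longrightarrow> (\<rho> (p k), g) \<in> adj G \<Longrightarrow>
        \<exists>h. hom M'' G h \<and> (\<forall>v\<in>verts M'. h v = \<rho> v) \<and> h w = g"
    by (rule pendant_edge[OF M'(1) pv[OF order_refl] G]) blast
  define p' where "p' = p(Suc k := w)"
  have 1: "hom M M'' id" using hom_comp[OF M'(2) M''(2)] by simp
  have 2: "(p' i, p' (Suc i)) \<in> adj M''" if "i < Suc k" for i
  proof (cases "i = k")
    case True
    then show ?thesis using M''(3) by (simp add: p'_def)
  next
    case False
    then show ?thesis using that hom_adj[OF M''(2) p(2)[of i]] by (simp add: p'_def)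
  qed
  have 3: "\<exists>h. hom M'' G h \<and> (\<forall>v\<in>verts M. h v = \<rho> v) \<and> (\<forall>i\<le>Suc k. h (p' i) = q i)"
    if \<rho>: "hom M G \<rho>" and q: "q 0 = \<rho> a" "\<forall>i<Suc k. (q i, q (Suc i)) \<in> adj G" for \<rho> q
  proof -
    obtain h where h: "hom M' G h" "\<forall>v\<in>verts M. h v = \<rho> v" "\<forall>i\<le>k. h (p i) = q i"
      using univ[of \<rho> q] \<rho> q by auto
    moreover have "(h (p k), q (Suc k)) \<in> adj G" using h(3) q(2) by simp
    ultimately obtain h' where h': "hom M'' G h'" "\<forall>v\<in>verts M'. h' v = h v" "h' w = q (Suc k)"
      using univ' by blast
    have "h' v = \<rho> v" if "v \<in> verts M" for v
      using that h(2) h'(2) hom_verts[OF M'(2) that] by simp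
    moreover have "h' (p' i) = q i" if "i \<le> Suc k" for i
      using that h(3) h'(2,3) pv[of i] by (cases "i = Suc k") (auto simp: p'_def)
    ultimately show ?thesis using h'(1) by blast
  qed
  have "p' 0 = a" using p by (simp add: p'_def)
  with M''(1) 1 2 3 show ?case by blast
qed

text \<open>Fold the component of \<open>a\<close> by distance layers onto the walk \<gamma>,
  starting at \<open>\<gamma> k\<close>. Adjacent vertices lie in consecutive layers, since their
  distances from \<open>a\<close> differ by at most one and have different parity. On the other
  components \<rho> is kept.\<close>

lemma hom_collapse_to_walk:
  assumes \<rho>: "hom M G \<rho>" and G: "finite_bigraph G" and a: "a \<in> verts G"
    and \<gamma>: "\<And>t. (\<gamma> t, \<gamma> (Suc t)) \<in> adj G" and k: "isl (\<gamma> k) = isl a"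
  shows "hom M G (\<lambda>m. if (a, \<rho> m) \<in> (adj G)\<^sup>* then \<gamma> (k + gdist G a (\<rho> m)) else \<rho> m)"
proof -
  have "(\<gamma> k, \<gamma> (k + t)) \<in> adj G ^^ t" for t
    by (rule relpow_segment) (use \<gamma> in simp)
  then have isl\<gamma>: "isl (\<gamma> (k + t)) \<longleftrightarrow> (isl a \<longleftrightarrow> even t)" for t
    using adj_relpow_isl k by blast
  have isl: "isl u \<longleftrightarrow> (isl a \<longleftrightarrow> even (gdist G a u))" if "(a, u) \<in> (adj G)\<^sup>*" for u
    using adj_relpow_isl[OF gdist_walk[OF that]] .
  have \<gamma>v: "\<gamma> t \<in> verts G" for t using adj_verts[OF G \<gamma>] by blast
  have step: "(\<gamma> (k + gdist G a u), \<gamma> (k + gdist G a u')) \<in> adj G"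
    if au: "(a, u) \<in> (adj G)\<^sup>*" and uu': "(u, u') \<in> adj G" for u u'
  proof -
    have au': "(a, u') \<in> (adj G)\<^sup>*" using au uu' by simp
    have "gdist G a u' \<le> Suc (gdist G a u)"
      by (rule gdist_le) (use gdist_walk[OF au] uu' in auto)
    moreover have "gdist G a u \<le> Suc (gdist G a u')"
      by (rule gdist_le) (use gdist_walk[OF au'] adj_sym[OF uu'] in auto)
    moreover have "even (gdist G a u') \<longleftrightarrow> odd (gdist G a u)"
      using isl[OF au] isl[OF au'] adj_isl[OF uu'] by blast
    ultimately have "gdist G a u' = Suc (gdist G a u) \<or> gdist G a u = Suc (gdist G a u')"
      by presburger
    then show ?thesis using \<gamma> adj_sym[OF \<gamma>] by auto
  qed
  have reach: "(a, u) \<in> (adj G)\<^sup>* \<longleftrightarrow> (a, u') \<in> (adj G)\<^sup>*" if "(u, u') \<in> adj G" for u u'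
    using that adj_sym[OF that] by (meson rtrancl.rtrancl_into_rtrancl)
  let ?h = "\<lambda>m. if (a, \<rho> m) \<in> (adj G)\<^sup>* then \<gamma> (k + gdist G a (\<rho> m)) else \<rho> m"
  have "(?h m, ?h m') \<in> adj G" if "(m, m') \<in> adj M" for m m'
    using hom_adj[OF \<rho> that] reach[OF hom_adj[OF \<rho> that]] step[of "\<rho> m" "\<rho> m'"] by simp
  moreover have "?h m \<in> verts G \<and> isl (?h m) = isl m" if "m \<in> verts M" for m
    using hom_verts[OF \<rho> that] hom_isl[OF \<rho> that] isl[of "\<rho> m"] isl\<gamma> \<gamma>v by simp
  ultimately show ?thesis unfolding hom_def by blast
qed

text \<open>In the second copy made by the doubling, the pendant walk traversed backwards and the
  given walk from \<open>a'\<close> to \<open>b'\<close> form a walk of length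
  \<open>k + z = (x - k) + y\<close>. It is mapped onto the last \<open>x - k\<close> steps of a
  geodesic from \<open>a\<close> to \<open>v\<close> followed by a geodesic from \<open>v\<close> to
  \<open>b\<close>; \<open>n\<close> is the vertex that lands on \<open>v\<close>. The first copy
  contributes the initial \<open>k\<close> steps from \<open>a'\<close>.\<close>

lemma attach_vertex:
  fixes G :: "('a, 'b) bigraph"
  assumes G: "finite_bigraph G" "no_isolated_vertices G"
    and M: "constructible_nat M" and \<rho>: "hom M G \<rho>"
    and a': "a' \<in> verts M" and b': "b' \<in> verts M"
    and ab: "\<rho> a' = a" "\<rho> b' = b" and walk: "(a', b') \<in> adj M ^^ gdist G a b"
    and av: "(a, v) \<in> (adj G)\<^sup>*" and bv: "(b, v) \<in> (adj G)\<^sup>*"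
  shows "\<exists>M' \<rho>' n. constructible_nat M' \<and> hom M M' id \<and> hom M' G \<rho>' \<and> (\<forall>m\<in>verts M. \<rho>' m = \<rho> m) \<and>
     n \<in> verts M' \<and> \<rho>' n = v \<and> (a', n) \<in> adj M' ^^ gdist G a v \<and> (b', n) \<in> adj M' ^^ gdist G b v"
proof -
  define x where "x = gdist G a v"
  define y where "y = gdist G b v"
  define z where "z = gdist G a b"
  have a: "a \<in> verts G" and b: "b \<in> verts G" using hom_verts[OF \<rho>] a' b' ab by auto
  have wx: "(a, v) \<in> adj G ^^ x" and wy: "(b, v) \<in> adj G ^^ y"
    unfolding x_def y_def using av bv gdist_walk by blast+
  have v: "v \<in> verts G" using adj_relpow_verts[OF G(1) wx a] .
  have wz: "(a, b) \<in> adj G ^^ z" unfolding z_def using hom_relpow[OF \<rho> walk] ab by simp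
  have wy': "(v, b) \<in> adj G ^^ y" using adj_relpow_sym[OF wy] .
  have "(a, b) \<in> adj G ^^ (x + y)" using relpow_trans[OF wx wy'] .
  then have "z \<le> x + y" unfolding z_def by (rule gdist_le)
  moreover have "even (x + y + z)"
    using adj_relpow_isl[OF wx] adj_relpow_isl[OF wy] adj_relpow_isl[OF wz] by auto
  \<comment> \<open>\<open>k\<close> is half the excess of the detour through \<open>v\<close> over
    the distance between \<open>a\<close> and \<open>b\<close>.\<close>
  ultimately obtain k where k: "x + y = z + 2 * k"
    by (metis add_diff_cancel_left' dvdE even_add even_diff_nat le_add_diff_inverse)
  have "(b, v) \<in> adj G ^^ (z + x)" using relpow_trans[OF adj_relpow_sym[OF wz] wx] .
  then have "y \<le> z + x" unfolding y_def by (rule gdist_le)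
  then have kx: "k \<le> x" using k by linarith
  obtain \<alpha> where \<alpha>: "\<alpha> 0 = a" "\<alpha> x = v" "\<And>i. (\<alpha> i, \<alpha> (Suc i)) \<in> adj G"
    by (rule extend_walk[OF G a wx]) blast
  obtain \<beta> where \<beta>: "\<beta> 0 = v" "\<beta> y = b" "\<And>i. (\<beta> i, \<beta> (Suc i)) \<in> adj G"
    by (rule extend_walk[OF G v wy']) blast
  \<comment> \<open>The walk starts at \<open>\<alpha> k\<close>, reaches \<open>v\<close> after
    \<open>x - k\<close> steps and \<open>b\<close> after \<open>y\<close> more.\<close>
  define \<gamma> where "\<gamma> t = (if t \<le> x - k then \<alpha> (k + t) else \<beta> (t - (x - k)))" for t
  have \<gamma>: "(\<gamma> t, \<gamma> (Suc t)) \<in> adj G" for t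
  proof -
    consider "t < x - k" | "t = x - k" | "t > x - k" by linarith
    then show ?thesis
    proof cases
      case 2
      then show ?thesis using \<alpha>(2) \<beta>(1) \<beta>(3)[of 0] kx by (simp add: \<gamma>_def)
    qed (use \<alpha> \<beta> in \<open>auto simp: \<gamma>_def Suc_diff_le\<close>)
  qed
  have \<gamma>v: "\<gamma> (x - k) = v" using \<alpha>(2) kx by (simp add: \<gamma>_def)
  have \<gamma>b: "\<gamma> (k + z) = b"
  \<comment> \<open>For \<open>y = 0\<close> the index falls into the first branch of \<gamma>,
    where \<open>v = b\<close>.\<close>
  proof (cases "y = 0")
    case True
    then have "k + z = x - k" using k by linarith
    then show ?thesis using \<gamma>v \<beta> True by simp
  next
    case False
    then have "\<not> k + z \<le> x - k" "k + z - (x - k) = y" using k kx by linarith+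
    then show ?thesis using \<beta> by (simp add: \<gamma>_def)
  qed
  have "(\<gamma> k, \<gamma> (k + z)) \<in> adj G ^^ z" by (rule relpow_segment) (use \<gamma> in simp)
  then have isl\<gamma>: "isl (\<gamma> k) = isl a"
    using adj_relpow_isl[OF wz] adj_relpow_isl \<gamma>b by blast
  \<comment> \<open>The fold for the second copy starts at \<open>\<gamma> k\<close>, which leaves
    the first \<open>k\<close> steps of \<gamma> for the reversed pendant walk.\<close>
  define \<rho>\<^sub>2 where "\<rho>\<^sub>2 m = (if (a, \<rho> m) \<in> (adj G)\<^sup>* then \<gamma> (k + gdist G a (\<rho> m)) else \<rho> m)" for m
  have \<rho>2: "hom M G \<rho>\<^sub>2"
    unfolding \<rho>\<^sub>2_def by (rule hom_collapse_to_walk[OF \<rho> G(1) a \<gamma> isl\<gamma>])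
  obtain M1 p where M1: "constructible_nat M1" "hom M M1 id" and p: "p 0 = a'"
    "\<And>i. i < k \<Longrightarrow> (p i, p (Suc i)) \<in> adj M1"
    and univ1: "\<And>\<rho> q. hom M G \<rho> \<Longrightarrow> q 0 = \<rho> a' \<Longrightarrow> (\<forall>i<k. (q i, q (Suc i)) \<in> adj G) \<Longrightarrow>
      (\<exists>h. hom M1 G h \<and> (\<forall>v\<in>verts M. h v = \<rho> v) \<and> (\<forall>i\<le>k. h (p i) = q i))"
    using pendant_walk[OF M a' G(1), of k] by blast
  have fM1: "finite_bigraph M1" using constructible_nat_wf[OF M1(1)] by simp
  obtain h1 where h1: "hom M1 G h1" "\<forall>v\<in>verts M. h1 v = \<rho> v" "\<forall>i\<le>k. h1 (p i) = \<alpha> i"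
    using univ1[of \<rho> \<alpha>] \<rho> \<alpha> ab by auto
  \<comment> \<open>In \<open>h1\<close> the pendant walk follows \<alpha>; in \<open>h2\<close> it
    follows \<gamma> backwards from \<open>\<gamma> k\<close> to \<open>\<gamma> 0\<close>.\<close>
  have "(\<gamma> (k - i), \<gamma> (k - Suc i)) \<in> adj G" if "i < k" for i
    using adj_sym[OF \<gamma>[of "k - Suc i"]] that by (simp add: Suc_diff_Suc)
  then obtain h2 where h2: "hom M1 G h2" "\<forall>v\<in>verts M. h2 v = \<rho>\<^sub>2 v" "\<forall>i\<le>k. h2 (p i) = \<gamma> (k - i)"
    using univ1[of \<rho>\<^sub>2 "\<lambda>i. \<gamma> (k - i)"] \<rho>2 ab by (auto simp: \<rho>\<^sub>2_def)
  have a1: "a' \<in> verts M1" and b1: "b' \<in> verts M1" using hom_verts[OF M1(2)] a' b' by auto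
  have wp: "(a', p k) \<in> adj M1 ^^ k"
    using relpow_segment[of k p 0 "adj M1"] p by simp
  have pk: "p k \<in> verts M1" using adj_relpow_verts[OF fM1 wp a1] .
  \<comment> \<open>The two maps agree on the vertices to be fixed: at \<open>p k\<close> because
    \<open>\<gamma> 0 = \<alpha> k\<close>, and at \<open>b'\<close> because \<open>b\<close> has
    distance \<open>z\<close> from \<open>a\<close> and \<open>\<gamma> (k + z) = b\<close>.\<close>
  have "h1 v = h2 v" if "v \<in> {p k, b'}" for v
  proof -
    have "\<gamma> 0 = \<alpha> k" by (simp add: \<gamma>_def)
    moreover have "\<rho>\<^sub>2 b' = b"
      using relpow_imp_rtrancl[OF wz] ab \<gamma>b by (simp add: \<rho>\<^sub>2_def z_def)
    ultimately show ?thesis using that h1 h2 b' ab by auto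
  qed
  note agree = this
  obtain M2 j where M2: "constructible_nat M2" "hom M1 M2 id" and j: "hom M1 M2 j"
    "\<And>v. v \<in> {p k, b'} \<Longrightarrow> v \<in> verts M1 \<Longrightarrow> j v = v"
    and univ2: "\<And>h\<^sub>1 h\<^sub>2. hom M1 G h\<^sub>1 \<Longrightarrow> hom M1 G h\<^sub>2 \<Longrightarrow>
       (\<And>v. v \<in> {p k, b'} \<Longrightarrow> v \<in> verts M1 \<Longrightarrow> h\<^sub>1 v = h\<^sub>2 v) \<Longrightarrow>
       \<exists>h. hom M2 G h \<and> (\<forall>v\<in>verts M1. h v = h\<^sub>1 v \<and> h (j v) = h\<^sub>2 v)"
    by (rule doubling_pushout[OF M1(1), where F = "{p k, b'}" and 'a = 'a and 'b = 'b]) blast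
  obtain h where h: "hom M2 G h" "\<And>v. v \<in> verts M1 \<Longrightarrow> h v = h1 v" "\<And>v. v \<in> verts M1 \<Longrightarrow> h (j v) = h2 v"
    using univ2[OF h1(1) h2(1) agree] by auto
  obtain \<mu> where \<mu>: "\<mu> 0 = a'" "\<mu> z = b'" "\<And>i. i < z \<Longrightarrow> (\<mu> i, \<mu> (Suc i)) \<in> adj M"
    using walk unfolding relpow_fun_conv z_def by blast
  \<comment> \<open>Back along the pendant walk to \<open>a'\<close>, then along the given walk to
    \<open>b'\<close>.\<close>
  define \<pi> where "\<pi> i = (if i \<le> k then p (k - i) else \<mu> (i - k))" for i
  have \<pi>: "(\<pi> i, \<pi> (Suc i)) \<in> adj M1" if "i < k + z" for i
  proof -
    consider "i < k" | "i = k" | "i > k" by linarith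
    then show ?thesis
    proof cases
      case 1
      then show ?thesis using adj_sym[OF p(2)[of "k - Suc i"]] by (simp add: \<pi>_def Suc_diff_Suc)
    next
      case 2
      then show ?thesis using that p(1) \<mu>(1) hom_adj[OF M1(2) \<mu>(3)[of 0]] by (simp add: \<pi>_def)
    next
      case 3
      then show ?thesis using that hom_adj[OF M1(2) \<mu>(3)[of "i - k"]] by (simp add: \<pi>_def Suc_diff_le)
    qed
  qed
  have \<pi>0: "\<pi> 0 = p k" by (simp add: \<pi>_def)
  have \<pi>b: "\<pi> (k + z) = b'" using p(1) \<mu> by (cases "z = 0") (auto simp: \<pi>_def)
  \<comment> \<open>The image of \<mu> joins \<open>a\<close> to \<open>b\<close> in
    \<open>z\<close> steps, hence is a geodesic; the fold \<open>\<rho>\<^sub>2\<close> therefore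
    lays it out along \<gamma> without backtracking.\<close>
  have \<mu>d: "gdist G a (\<rho> (\<mu> s)) = s" "(a, \<rho> (\<mu> s)) \<in> (adj G)\<^sup>*" "\<mu> s \<in> verts M" if "s \<le> z" for s
  proof -
    have "(\<mu> 0, \<mu> (0 + s)) \<in> adj M ^^ s" by (rule relpow_segment) (use that \<mu> in auto)
    then have ms: "(a', \<mu> s) \<in> adj M ^^ s" using \<mu> by simp
    have 1: "(a, \<rho> (\<mu> s)) \<in> adj G ^^ s" using hom_relpow[OF \<rho> ms] ab by simp
    have "(\<mu> s, \<mu> (s + (z - s))) \<in> adj M ^^ (z - s)" by (rule relpow_segment) (use that \<mu> in auto)
    then have "(\<mu> s, b') \<in> adj M ^^ (z - s)" using \<mu> that by simp
    then have 2: "(\<rho> (\<mu> s), b) \<in> adj G ^^ (z - s)" using hom_relpow[OF \<rho>] ab by blast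
    show 3: "(a, \<rho> (\<mu> s)) \<in> (adj G)\<^sup>*" using relpow_imp_rtrancl[OF 1] .
    have "gdist G a (\<rho> (\<mu> s)) \<le> s" by (rule gdist_le[OF 1])
    moreover have "z \<le> gdist G a (\<rho> (\<mu> s)) + (z - s)"
      unfolding z_def by (rule gdist_le) (use relpow_trans[OF gdist_walk[OF 3] 2] in \<open>simp add: z_def\<close>)
    ultimately show "gdist G a (\<rho> (\<mu> s)) = s" using that by linarith
    show "\<mu> s \<in> verts M"
      using adj_relpow_verts[OF _ ms a'] constructible_nat_wf[OF M] by blast
  qed
  have h2\<pi>: "h2 (\<pi> i) = \<gamma> i" if "i \<le> k + z" for i
  proof (cases "i \<le> k")
    case True
    then show ?thesis using h2(3) by (simp add: \<pi>_def)
  next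
    case False
    then show ?thesis using h2(2) \<mu>d[of "i - k"] that by (simp add: \<pi>_def \<rho>\<^sub>2_def)
  qed
  have len: "x - k \<le> k + z" "x - k + y = k + z" using k kx by linarith+
  have w1: "(p k, \<pi> (x - k)) \<in> adj M1 ^^ (x - k)"
    using relpow_segment[of "x - k" \<pi> 0 "adj M1"] \<pi> \<pi>0 len(1) by auto
  have w2: "(\<pi> (x - k), b') \<in> adj M1 ^^ y"
    using relpow_segment[of y \<pi> "x - k" "adj M1"] \<pi> \<pi>b len by auto
  have nv: "\<pi> (x - k) \<in> verts M1" using adj_relpow_verts[OF fM1 w1 pk] .
  \<comment> \<open>The walk from \<open>a'\<close> takes \<open>k\<close> steps in the first copy
    up to the fixed vertex \<open>p k\<close> and \<open>x - k\<close> steps in the second. The walk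
    from \<open>b'\<close>, which is fixed too, stays in the second copy.\<close>
  have "(a', p k) \<in> adj M2 ^^ k" using hom_relpow[OF M2(2) wp] by simp
  moreover have "(p k, j (\<pi> (x - k))) \<in> adj M2 ^^ (x - k)"
    using hom_relpow[OF j(1) w1] j(2)[of "p k"] pk by simp
  ultimately have "(a', j (\<pi> (x - k))) \<in> adj M2 ^^ x"
    using relpow_trans kx by (metis le_add_diff_inverse)
  moreover have "(b', j (\<pi> (x - k))) \<in> adj M2 ^^ y"
    using adj_relpow_sym[OF hom_relpow[OF j(1) w2]] j(2)[of b'] b1 by simp
  moreover have "h (j (\<pi> (x - k))) = v" using h(3)[OF nv] h2\<pi>[OF len(1)] \<gamma>v by simp
  moreover have "hom M M2 id" using hom_comp[OF M1(2) M2(2)] by simp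
  moreover have "\<forall>m\<in>verts M. h m = \<rho> m"
    using h(2) h1(2) hom_verts[OF M1(2)] by simp
  moreover have "j (\<pi> (x - k)) \<in> verts M2" using hom_verts[OF j(1) nv] .
  ultimately show ?thesis unfolding x_def[symmetric] y_def[symmetric] using M2(1) h(1) by blast
qed

text \<open>The state of the construction: \<open>W\<close> holds the vertices placed so far, and
  \<open>K\<close> the pairs that share a bucket. The walks in \<open>M\<close> stand for the
  subdivided edges of the chordal completion.\<close>

definition realizable ::
  "('a, 'b) bigraph \<Rightarrow> ('a + 'b) set \<Rightarrow> (('a + 'b) \<times> ('a + 'b)) set \<Rightarrow> bool" where
  "realizable G W K \<longleftrightarrow> (\<exists>M \<rho> \<iota>. constructible_nat M \<and> hom M G \<rho> \<and>
     (\<forall>v\<in>W. \<iota> v \<in> verts M \<and> \<rho> (\<iota> v) = v) \<and>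
     (\<forall>(a, b)\<in>K. (a, b) \<in> (adj G)\<^sup>* \<longrightarrow> (\<iota> a, \<iota> b) \<in> adj M ^^ gdist G a b))"

text \<open>Only members of \<open>S\<close> in the component of \<open>v\<close> require a walk. If
  there are none, a disjoint copy of \<open>M\<close> folded onto an edge at \<open>v\<close>
  supplies the new vertex. Otherwise they form \<open>{a, b}\<close>, possibly with
  \<open>a = b\<close>, and the ear construction applies.\<close>

lemma realizable_insert:
  fixes G :: "('a, 'b) bigraph"
  assumes G: "finite_bigraph G" "no_isolated_vertices G"
    and real: "realizable G W K" and K: "K \<subseteq> W \<times> W" and v: "v \<in> verts G" "v \<notin> W"
    and S: "S \<subseteq> W" "S \<times> S \<subseteq> K" "finite S" "card S \<le> 2"
  shows "realizable G (insert v W) (K \<union> insert v S \<times> insert v S)"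
proof -
  obtain M \<rho> \<iota> where M: "constructible_nat M" and \<rho>: "hom M G \<rho>"
    and \<iota>: "\<And>v. v \<in> W \<Longrightarrow> \<iota> v \<in> verts M" "\<And>v. v \<in> W \<Longrightarrow> \<rho> (\<iota> v) = v"
    and walk: "\<And>a b. (a, b) \<in> K \<Longrightarrow> (a, b) \<in> (adj G)\<^sup>* \<Longrightarrow> (\<iota> a, \<iota> b) \<in> adj M ^^ gdist G a b"
    using real unfolding realizable_def by blast
  define S' where "S' = {s\<in>S. (s, v) \<in> (adj G)\<^sup>*}"
  have "\<exists>M' \<rho>' n. constructible_nat M' \<and> hom M M' id \<and> hom M' G \<rho>' \<and> (\<forall>m\<in>verts M. \<rho>' m = \<rho> m) \<and>
     n \<in> verts M' \<and> \<rho>' n = v \<and> (\<forall>s\<in>S'. (\<iota> s, n) \<in> adj M' ^^ gdist G s v)"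
  proof (cases "S' = {}")
    case True
    obtain u where u: "(v, u) \<in> adj G" using ex_adj[OF G(2) v(1)] by blast
    have wfM: "finite_bigraph M" "edges M \<noteq> {}" using constructible_nat_wf[OF M] by auto
    then obtain p q where pq: "(p, q) \<in> edges M" by fastforce
    then have *: "Inl p \<in> verts M" "Inr q \<in> verts M" using adj_verts[OF wfM(1), of "Inl p" "Inr q"] by auto
    have "\<exists>m\<in>verts M. isl m \<longleftrightarrow> isl v"
      by (cases "isl v") (use bexI[OF _ *(1)] bexI[OF _ *(2)] in auto)
    then obtain m where m: "m \<in> verts M" "isl m \<longleftrightarrow> isl v" by blast
    obtain M' j where M': "constructible_nat M'" "hom M M' id" and j: "hom M M' j"
      and univ: "\<And>h\<^sub>1 h\<^sub>2. hom M G h\<^sub>1 \<Longrightarrow> hom M G h\<^sub>2 \<Longrightarrow>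
         (\<And>v. v \<in> {} \<Longrightarrow> v \<in> verts M \<Longrightarrow> h\<^sub>1 v = h\<^sub>2 v) \<Longrightarrow>
         \<exists>h. hom M' G h \<and> (\<forall>v\<in>verts M. h v = h\<^sub>1 v \<and> h (j v) = h\<^sub>2 v)"
      by (rule doubling_pushout[OF M, where F = "{}" and 'a = 'a and 'b = 'b]) blast
    obtain h where h: "hom M' G h" "\<forall>m\<in>verts M. h m = \<rho> m \<and> h (j m) = (if isl m \<longleftrightarrow> isl v then v else u)"
      using univ[OF \<rho> hom_fold[OF G(1) u]] by auto
    then show ?thesis using M' True m hom_verts[OF j] by (intro exI[of _ M'] exI[of _ h] exI[of _ "j m"]) auto
  next
    case False
    then obtain a where a: "a \<in> S'" by blast
    have "card (S' - {a}) \<le> 1"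
      using a S(3,4) card_mono[of S S'] by (simp add: S'_def card_Diff_singleton)
    have "\<exists>b. S' = {a, b}"
    proof (cases "S' - {a} = {}")
      case True
      then show ?thesis using a by (intro exI[of _ a]) blast
    next
      case False
      have "finite (S' - {a})" using S(3) by (simp add: S'_def)
      with False \<open>card (S' - {a}) \<le> 1\<close> have "card (S' - {a}) = 1"
        using card_gt_0_iff[of "S' - {a}"] by linarith
      then obtain b where "S' - {a} = {b}" using card_1_singletonE by blast
      then show ?thesis using a by (intro exI[of _ b]) blast
    qed
    then obtain b where b: "S' = {a, b}" by blast
    have "a \<in> S" "b \<in> S" and av: "(a, v) \<in> (adj G)\<^sup>*" and bv: "(b, v) \<in> (adj G)\<^sup>*"
      using b unfolding S'_def by auto
    moreover have "(a, b) \<in> (adj G)\<^sup>*"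
      using av adj_rtrancl_sym[OF bv] by simp
    ultimately have "(\<iota> a, \<iota> b) \<in> adj M ^^ gdist G a b" using walk S by auto
    with attach_vertex[OF G M \<rho> _ _ _ _ _ av bv, of "\<iota> a" "\<iota> b"] show ?thesis
      using \<open>a \<in> S\<close> \<open>b \<in> S\<close> S \<iota> unfolding b by (simp add: subset_iff)
  qed
  then obtain M' \<rho>' n where M': "constructible_nat M'" and i: "hom M M' id" and \<rho>': "hom M' G \<rho>'"
    "\<And>m. m \<in> verts M \<Longrightarrow> \<rho>' m = \<rho> m" and n: "n \<in> verts M'" "\<rho>' n = v"
    and wn: "\<And>s. s \<in> S' \<Longrightarrow> (\<iota> s, n) \<in> adj M' ^^ gdist G s v"
    by blast
  define \<iota>' where "\<iota>' = \<iota>(v := n)"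
  have "\<iota>' w \<in> verts M' \<and> \<rho>' (\<iota>' w) = w" if "w \<in> insert v W" for w
    using that n \<iota> \<rho>'(2) hom_verts[OF i] by (auto simp: \<iota>'_def)
  moreover have "(\<iota>' a, \<iota>' b) \<in> adj M' ^^ gdist G a b"
    if ab: "(a, b) \<in> K \<union> insert v S \<times> insert v S" and reach: "(a, b) \<in> (adj G)\<^sup>*" for a b
  proof -
    have "S \<times> S \<subseteq> K" by fact
    then consider "(a, b) \<in> K" | "a = v" "b = v" | "a \<in> S" "b = v" | "a = v" "b \<in> S"
      using ab by blast
    then show ?thesis
    proof cases
      case 1
      then have "a \<noteq> v" "b \<noteq> v" using K v by auto
      then show ?thesis using hom_relpow[OF i walk[OF 1 reach]] by (simp add: \<iota>'_def)
    next
      case 2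
      then show ?thesis by simp
    next
      case 3
      then have "a \<in> S'" "a \<noteq> v" using reach S v by (auto simp: S'_def)
      then show ?thesis using wn 3 by (simp add: \<iota>'_def)
    next
      case 4
      then have "b \<in> S'" "b \<noteq> v" using adj_rtrancl_sym[OF reach] S v by (auto simp: S'_def)
      then show ?thesis using adj_relpow_sym[OF wn] 4 by (simp add: \<iota>'_def gdist_commute)
    qed
  qed
  ultimately show ?thesis unfolding realizable_def using M' \<rho>'(1) by blast
qed

section \<open>Tree decompositions\<close>

text \<open>The bucket is \<open>S \<union> C\<close>, with \<open>C\<close> its new vertices. They
  are placed one at a time; as the bucket has at most three members, each of them meets at most two
  that are already placed.\<close>

lemma realizable_bucket:
  fixes G :: "('a, 'b) bigraph"
  assumes G: "finite_bigraph G" "no_isolated_vertices G"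
    and real: "realizable G W K" and K: "K \<subseteq> W \<times> W" and fin: "finite C" "finite S"
    and C: "C \<subseteq> verts G" "C \<inter> W = {}"
    and S: "S \<subseteq> W" "S \<times> S \<subseteq> K" and card: "card (S \<union> C) \<le> 3"
  shows "realizable G (W \<union> C) (K \<union> (S \<union> C) \<times> (S \<union> C))"
  using fin(1) C card
proof (induction C rule: finite_induct)
  case empty
  have "K \<union> S \<times> S = K" using S(2) by blast
  then show ?case using real by simp
next
  case (insert v C)
  have eq: "S \<union> insert v C = insert v (S \<union> C)" by simp
  have "v \<notin> S \<union> C" using insert S(1) by blast
  then have card: "card (S \<union> C) \<le> 2"
    using insert.prems(3) fin(2) insert.hyps(1) unfolding eq by simp
  let ?K = "K \<union> (S \<union> C) \<times> (S \<union> C)"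
  have "realizable G (W \<union> C) ?K" using insert.IH insert.prems card by auto
  then have "realizable G (insert v (W \<union> C)) (?K \<union> insert v (S \<union> C) \<times> insert v (S \<union> C))"
    by (rule realizable_insert[OF G]) (use K S insert card fin in auto)
  moreover have "?K \<union> insert v (S \<union> C) \<times> insert v (S \<union> C)
      = K \<union> insert v (S \<union> C) \<times> insert v (S \<union> C)" by blast
  ultimately show ?case unfolding eq by simp
qed

section \<open>Cycles and separation in trees\<close>

lemma rtrancl_simple_path:
  assumes "(u, v) \<in> R\<^sup>*"
  obtains vs where "vs \<noteq> []" "hd vs = u" "last vs = v" "distinct vs" "successively (\<lambda>a b. (a, b) \<in> R) vs"
proof -
  have "\<exists>vs. vs \<noteq> [] \<and> hd vs = u \<and> last vs = v \<and> distinct vs \<and> successively (\<lambda>a b. (a, b) \<in> R) vs"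
    using assms
  proof (induction rule: rtrancl_induct)
    case base
    then show ?case by (intro exI[of _ "[u]"]) auto
  next
    case (step y z)
    then obtain vs where vs: "vs \<noteq> []" "hd vs = u" "last vs = y" "distinct vs"
      "successively (\<lambda>a b. (a, b) \<in> R) vs" by blast
    show ?case
    proof (cases "z \<in> set vs")
      case False
      have "successively (\<lambda>a b. (a, b) \<in> R) (vs @ [z])"
        using vs(1,3,5) step.hyps(2) by (simp add: successively_append_iff)
      then show ?thesis using vs(1,2,4) False by (intro exI[of _ "vs @ [z]"]) simp
    next
      case True
      \<comment> \<open>A path that returns to \<open>z\<close> is cut at the earlier occurrence of
        \<open>z\<close>.\<close>
      then obtain xs ys where eq: "vs = xs @ z # ys" using split_list[OF True] by blast
      have "successively (\<lambda>a b. (a, b) \<in> R) (xs @ [z])"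
        using vs(5) unfolding eq by (auto simp: successively_append_iff)
      moreover have "hd (xs @ [z]) = u" using vs(2) unfolding eq by (cases xs) auto
      ultimately show ?thesis using vs(4) unfolding eq by (intro exI[of _ "xs @ [z]"]) simp
    qed
  qed
  then show ?thesis using that by blast
qed

text \<open>A simple path from \<open>u\<close> to \<open>v\<close> avoiding the edge is closed up
  by it. The path has at least three vertices: one is excluded by \<open>u \<noteq> v\<close>, and
  two would make it the avoided edge.\<close>

lemma cycle_through_edge:
  assumes "u \<noteq> v" "{u, v} \<in> F" "(u, v) \<in> {(a, b). {a, b} \<in> F \<and> {a, b} \<noteq> {u, v}}\<^sup>*"
  shows "\<exists>vs. is_cycle F vs"
proof -
  obtain vs where vs: "vs \<noteq> []" "hd vs = u" "last vs = v" "distinct vs"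
    and succ: "successively (\<lambda>a b. (a, b) \<in> {(a, b). {a, b} \<in> F \<and> {a, b} \<noteq> {u, v}}) vs"
    by (rule rtrancl_simple_path[OF assms(3)])
  have edge: "{vs ! i, vs ! Suc i} \<in> F" "{vs ! i, vs ! Suc i} \<noteq> {u, v}" if "Suc i < length vs" for i
    using succ that unfolding successively_conv_nth by auto
  have hd: "vs ! 0 = u" and last: "vs ! (length vs - 1) = v"
    using vs by (auto simp: hd_conv_nth last_conv_nth)
  have "length vs \<noteq> 1" using hd last assms(1) by auto
  moreover have "length vs \<noteq> 2" using hd last edge(2)[of 0] by auto
  ultimately have len: "3 \<le> length vs" using vs(1) by (cases "length vs") auto
  have "{vs ! i, vs ! (Suc i mod length vs)} \<in> F" if "i < length vs" for i
  proof (cases "Suc i = length vs")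
    case True
    then have "i = length vs - 1" by simp
    then show ?thesis using True hd last assms(2) by (simp add: insert_commute)
  next
    case False
    then show ?thesis using edge(1)[of i] that by simp
  qed
  then show ?thesis unfolding is_cycle_def using len vs(4) by blast
qed

text \<open>If \<open>v\<close> were missing from \<open>B'\<close>, the buckets containing
  \<open>v\<close> would connect \<open>B\<close> to \<open>B''\<close> without the edge between
  \<open>B\<close> and \<open>B'\<close>, and \<open>P\<close> would connect \<open>B''\<close> to
  \<open>B'\<close> without it because \<open>B \<notin> P\<close>. The edge would then lie on a
  cycle.\<close>

lemma tree_separation:
  assumes tree: "is_tree N T" and P: "connected_in P T" "B' \<in> P" "B \<notin> P" "{B, B'} \<in> T" and B: "B \<in> N"
    and v: "connected_in {B\<in>N. v \<in> B} T" "v \<in> B" "B'' \<in> P" "B'' \<in> N" "v \<in> B''"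
  shows "v \<in> B'"
proof (rule ccontr)
  assume v': "v \<notin> B'"
  let ?R = "{(a, b). {a, b} \<in> T \<and> {a, b} \<noteq> {B, B'}}"
  have "(B, B'') \<in> {(a, b). a \<in> {B\<in>N. v \<in> B} \<and> b \<in> {B\<in>N. v \<in> B} \<and> {a, b} \<in> T}\<^sup>*"
    using v B unfolding connected_in_def by simp
  moreover have "{(a, b). a \<in> {B\<in>N. v \<in> B} \<and> b \<in> {B\<in>N. v \<in> B} \<and> {a, b} \<in> T} \<subseteq> ?R"
    using v' by (auto simp: doubleton_eq_iff)
  ultimately have 1: "(B, B'') \<in> ?R\<^sup>*" by (rule rtrancl_mono[THEN subsetD, rotated])
  have "(B'', B') \<in> {(a, b). a \<in> P \<and> b \<in> P \<and> {a, b} \<in> T}\<^sup>*"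
    using v P unfolding connected_in_def by simp
  moreover have "{(a, b). a \<in> P \<and> b \<in> P \<and> {a, b} \<in> T} \<subseteq> ?R"
    using P(3) by (auto simp: doubleton_eq_iff)
  ultimately have "(B'', B') \<in> ?R\<^sup>*" by (rule rtrancl_mono[THEN subsetD, rotated])
  with 1 have "(B, B') \<in> ?R\<^sup>*" by (rule rtrancl_trans)
  moreover have "B \<noteq> B'" using P by blast
  ultimately show False
    using cycle_through_edge[of B B' T] P(4) tree unfolding is_tree_def by blast
qed

lemma connected_in_insert:
  assumes "connected_in P T" "B' \<in> P" "{B, B'} \<in> T"
  shows "connected_in (insert B P) T"
proof -
  let ?R = "{(a, b). a \<in> insert B P \<and> b \<in> insert B P \<and> {a, b} \<in> T}"
  have "{(a, b). a \<in> P \<and> b \<in> P \<and> {a, b} \<in> T} \<subseteq> ?R" by auto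
  note mono = rtrancl_mono[OF this, THEN subsetD]
  have P: "(u, v) \<in> ?R\<^sup>*" if "u \<in> P" "v \<in> P" for u v
    by (rule mono) (use assms(1) that in \<open>simp add: connected_in_def\<close>)
  have B: "(B, B') \<in> ?R" "(B', B) \<in> ?R" using assms by (auto simp: insert_commute)
  have B1: "(B, v) \<in> ?R\<^sup>*" if "v \<in> P" for v
    by (rule converse_rtrancl_into_rtrancl[OF B(1) P[OF assms(2) that]])
  have B2: "(v, B) \<in> ?R\<^sup>*" if "v \<in> P" for v
    by (rule rtrancl_into_rtrancl[OF P[OF that assms(2)] B(2)])
  have "(u, v) \<in> ?R\<^sup>*" if "u \<in> insert B P" "v \<in> insert B P" for u v
    using that P B1 B2 by (elim insertE) auto
  then show ?thesis unfolding connected_in_def by simp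
qed

text \<open>A subtree \<open>P\<close> of the decomposition grows by one neighbouring bucket at a
  time. By separation, what the new bucket \<open>B\<close> shares with the earlier ones lies within
  its neighbour \<open>B'\<close>, so the pairs of shared vertices already have their walks.\<close>

lemma realizable_tree_decomposition:
  fixes G :: "('a, 'b) bigraph"
  assumes G: "finite_bigraph G" "no_isolated_vertices G" "edges G \<noteq> {}"
    and td: "tree_decomposition (verts G) F N T" and card: "\<And>B. B \<in> N \<Longrightarrow> card B \<le> 3"
  shows "realizable G (verts G) (\<Union>B\<in>N. B \<times> B)"
proof -
  have finV: "finite (verts G)" using G by (auto simp: finite_bigraph_def verts_def)
  have N: "N \<subseteq> Pow (verts G)" and tree: "is_tree N T"
    and conn: "\<And>v. v \<in> verts G \<Longrightarrow> connected_in {B\<in>N. v \<in> B} T"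
    using td by (auto simp: tree_decomposition_def)
  have finN: "finite N" using N finV by (meson finite_Pow_iff finite_subset)
  have connN: "connected_in N T" using tree by (simp add: is_tree_def)
  define good where "good P \<longleftrightarrow> P \<subseteq> N \<and> connected_in P T \<and> realizable G (\<Union>P) (\<Union>B\<in>P. B \<times> B)" for P
  have fin: "finite B" if "B \<in> N" for B using that N finV by (auto intro: finite_subset)
  obtain B0 where B0: "B0 \<in> N" using connN by (auto simp: connected_in_def)
  \<comment> \<open>The start is a single edge folded onto some edge of \<open>G\<close>, with no
    vertex placed yet.\<close>
  have "realizable G {} {}"
  proof -
    obtain x y where xy: "(Inl x, Inr y) \<in> adj G" using G(3) by fastforce
    have "constructible_nat \<lparr>left = {0}, right = {0}, edges = {(0, 0)}\<rparr>" by (rule single_edge)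
    then show ?thesis unfolding realizable_def using hom_fold[OF G(1) xy] by auto
  qed
  then have "realizable G ({} \<union> B0) ({} \<union> ({} \<union> B0) \<times> ({} \<union> B0))"
    by (rule realizable_bucket[OF G(1,2)]) (use B0 N card fin in auto)
  then have "good {B0}" using B0 by (auto simp: good_def connected_in_def)
  have step: "\<exists>B\<in>N - P. good (insert B P)" if P: "good P" "P \<noteq> N" for P
  proof -
    have PN: "P \<subseteq> N" and cP: "connected_in P T" and rP: "realizable G (\<Union>P) (\<Union>B\<in>P. B \<times> B)"
      using P by (auto simp: good_def)
    obtain p q where p: "p \<in> P" and q: "q \<in> N" "q \<notin> P"
      using P cP by (auto simp: good_def connected_in_def)
    have "(p, q) \<in> {(a, b). a \<in> N \<and> b \<in> N \<and> {a, b} \<in> T}\<^sup>*"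
      using connN p q subsetD[OF PN p] unfolding connected_in_def by simp
    \<comment> \<open>A walk in the tree from \<open>p\<close> inside \<open>P\<close> to
      \<open>q\<close> outside must leave \<open>P\<close> along some edge.\<close>
    then have "q \<notin> P \<longrightarrow> (\<exists>B' B. B' \<in> P \<and> B \<in> N \<and> B \<notin> P \<and> {B', B} \<in> T)"
    proof (induction rule: rtrancl_induct)
      case base
      then show ?case using p by simp
    next
      case (step y z)
      then show ?case by blast
    qed
    then obtain B' B where B: "B' \<in> P" "B \<in> N" "B \<notin> P" "{B, B'} \<in> T"
      using q by (metis insert_commute)
    have sub: "B \<inter> \<Union>P \<subseteq> B'"
    proof
      fix v assume "v \<in> B \<inter> \<Union>P"
      then obtain B'' where B'': "v \<in> B" "B'' \<in> P" "v \<in> B''" by blast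
      have "v \<in> verts G" using B'' B N by blast
      from tree_separation[OF tree cP B(1,3,4,2) conn[OF this] B''(1,2) _ B''(3)] B''(2) PN
      show "v \<in> B'" by blast
    qed
    let ?C = "B - \<Union>P" and ?S = "B \<inter> \<Union>P"
    have SC: "?S \<union> ?C = B" by blast
    have "realizable G (\<Union>P \<union> ?C) ((\<Union>B\<in>P. B \<times> B) \<union> (?S \<union> ?C) \<times> (?S \<union> ?C))"
    proof (rule realizable_bucket[OF G(1,2) rP])
      show "?S \<times> ?S \<subseteq> (\<Union>B\<in>P. B \<times> B)" using sub B(1) by blast
      show "?C \<subseteq> verts G" using B(2) N by blast
      show "card (?S \<union> ?C) \<le> 3" unfolding SC using card B(2) .
    qed (use fin[OF B(2)] in auto)
    moreover have "\<Union>P \<union> ?C = \<Union>(insert B P)" by blast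
    moreover have "(\<Union>B\<in>P. B \<times> B) \<union> (?S \<union> ?C) \<times> (?S \<union> ?C) = (\<Union>B\<in>insert B P. B \<times> B)"
      unfolding SC by blast
    ultimately have "good (insert B P)"
      unfolding good_def using PN B connected_in_insert[OF cP B(1,4)] by auto
    then show ?thesis using B by blast
  qed
  have "good N" if "good P" for P
    using that
  proof (induction "card (N - P)" arbitrary: P rule: less_induct)
    case less
    show ?case
    proof (cases "P = N")
      case False
      then obtain B where B: "B \<in> N - P" "good (insert B P)" using step less.prems by blast
      have "card (N - insert B P) < card (N - P)"
        by (rule psubset_card_mono) (use finN B in auto)
      then show ?thesis using less.hyps B(2) by blast
    qed (use less.prems in simp)
  qed
  then have "good N" using \<open>good {B0}\<close> by blast
  moreover have "\<Union>N = verts G"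
  proof
    show "\<Union>N \<subseteq> verts G" using N by blast
    show "verts G \<subseteq> \<Union>N" using conn by (fastforce simp: connected_in_def)
  qed
  ultimately show ?thesis by (simp add: good_def)
qed

section \<open>Existence of an optimal tree decomposition\<close>

lemma treewidth_attained:
  assumes "finite V" and F: "\<And>e. e \<in> F \<Longrightarrow> e \<subseteq> V"
  obtains N T where "tree_decomposition V F N T" "treewidth V F = decomposition_width N"
proof -
  define Q where "Q w \<longleftrightarrow> (\<exists>N T. tree_decomposition V F N T \<and> w = decomposition_width N)" for w
  \<comment> \<open>The integers are not well-ordered, but every width has the form
    \<open>int n - 1\<close>, so the minimum can be taken over natural numbers. The decomposition
    with a single bucket shows that some width exists.\<close>
  define k where "k = (LEAST n. Q (int n - 1))"
  have "\<not> is_cycle {} vs" for vs :: "'a set list"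
    unfolding is_cycle_def by (cases vs) auto
  then have "tree_decomposition V F {V} {}"
    using F by (auto simp: tree_decomposition_def is_tree_def simple_graph_def connected_in_def)
  then have "Q (decomposition_width {V})" unfolding Q_def by blast
  then have "Q (int (card V) - 1)" by (simp add: decomposition_width_def)
  then have k: "Q (int k - 1)" unfolding k_def by (rule LeastI)
  have "int k - 1 \<le> w" if w: "Q w" for w
  proof -
    obtain n where n: "w = int n - 1" using w by (auto simp: Q_def decomposition_width_def)
    then have "k \<le> n" unfolding k_def using w by (auto intro: Least_le)
    then show ?thesis using n by simp
  qed
  then have "(LEAST w. Q w) = int k - 1" using k by (intro Least_equality) auto
  then have "treewidth V F = int k - 1" unfolding treewidth_def Q_def .
  then show ?thesis using k that unfolding Q_def by auto
qed

text \<open>The ends of an edge share a bucket and have distance one, so the walk between their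
  representatives is an edge. Hence the section \<iota> preserves adjacency and exhibits
  \<open>G\<close> as a retract of \<open>M\<close>.\<close>

theorem constructible_if_treewidth_le_2:
  fixes G :: "('a, 'b) bigraph"
  assumes G: "finite_bigraph G" "no_isolated_vertices G" "edges G \<noteq> {}" and tw: "bigraph_treewidth G \<le> 2"
  shows "constructible_by_conditioning G"
proof -
  let ?F = "(\<lambda>(x, y). {Inl x, Inr y}) ` edges G"
  have finV: "finite (verts G)" and E: "edges G \<subseteq> left G \<times> right G"
    using G by (auto simp: finite_bigraph_def verts_def)
  obtain N T where td: "tree_decomposition (verts G) ?F N T"
    and width: "treewidth (verts G) ?F = decomposition_width N"
    by (rule treewidth_attained[of "verts G" ?F]) (use finV E in \<open>auto simp: verts_def\<close>)
  have finN: "finite N"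
    using td finV unfolding tree_decomposition_def by (meson finite_Pow_iff finite_subset)
  have Max: "Max (card ` N) \<le> 3"
    using width tw unfolding bigraph_treewidth_def verts_def[symmetric] decomposition_width_def by linarith
  have "card B \<le> 3" if "B \<in> N" for B
    by (rule order_trans[OF Max_ge Max]) (use finN that in auto)
  then have "realizable G (verts G) (\<Union>B\<in>N. B \<times> B)"
    by (rule realizable_tree_decomposition[OF G td])
  then obtain M \<rho> \<iota> where M: "constructible_nat M" "hom M G \<rho>"
    and \<iota>: "\<forall>v\<in>verts G. \<iota> v \<in> verts M \<and> \<rho> (\<iota> v) = v"
    and walk: "\<forall>(a, b)\<in>(\<Union>B\<in>N. B \<times> B). (a, b) \<in> (adj G)\<^sup>* \<longrightarrow> (\<iota> a, \<iota> b) \<in> adj M ^^ gdist G a b"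
    unfolding realizable_def by (elim exE conjE) (rule that)
  show ?thesis
  proof (rule retract_constructible[OF M bspec[OF \<iota>] _ G(1)])
    fix u v assume uv: "(u, v) \<in> adj G"
    have "{u, v} \<in> ?F" using uv by (auto simp: adj_def insert_commute)
    moreover have "\<forall>e\<in>?F. \<exists>B\<in>N. e \<subseteq> B" using td by (simp add: tree_decomposition_def)
    ultimately obtain B where "B \<in> N" "{u, v} \<subseteq> B" by (meson bspec)
    then have "(u, v) \<in> (\<Union>B\<in>N. B \<times> B)" by auto
    from bspec[OF walk this] have w: "(\<iota> u, \<iota> v) \<in> adj M ^^ gdist G u v"
      using r_into_rtrancl[OF uv] by simp
    have "(u, v) \<in> adj G ^^ 1" using uv by simp
    then have "gdist G u v \<le> 1" by (rule gdist_le)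
    \<comment> \<open>Distance zero would identify two vertices on different sides.\<close>
    moreover have "gdist G u v \<noteq> 0"
      using gdist_walk[OF r_into_rtrancl[OF uv]] adj_isl[OF uv] by (intro notI) auto
    ultimately have "gdist G u v = 1" by linarith
    then show "(\<iota> u, \<iota> v) \<in> adj M" using w by simp
  qed
qed

section \<open>Random homomorphisms\<close>

lemma tuples_Suc: "tuples (Suc n) A = (\<lambda>(x, xs). x # xs) ` (A \<times> tuples n A)"
proof
  show "tuples (Suc n) A \<subseteq> (\<lambda>(x, xs). x # xs) ` (A \<times> tuples n A)"
  proof
    fix xs assume "xs \<in> tuples (Suc n) A"
    then obtain y ys where "xs = y # ys" "y \<in> A" "ys \<in> tuples n A"
      by (cases xs) (auto simp: tuples_def)
    then show "xs \<in> (\<lambda>(x, xs). x # xs) ` (A \<times> tuples n A)" by force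
  qed
qed (auto simp: tuples_def)

lemma finite_tuples: "finite A \<Longrightarrow> finite (tuples n A)"
  using finite_lists_length_eq[of A n] by (simp add: tuples_def conj_commute)

text \<open>Distributivity. For weights of total one the product weights form a probability
  distribution; for a subset of the sample space the formula gives the probability that all
  coordinates lie in it.\<close>

lemma sum_tuples_prod_list:
  fixes w :: "'a \<Rightarrow> real"
  shows "(\<Sum>xs\<in>tuples n A. prod_list (map w xs)) = (\<Sum>x\<in>A. w x) ^ n"
proof (induction n)
  case 0
  have "tuples 0 A = {[]}" by (auto simp: tuples_def)
  then show ?case by simp
next
  case (Suc n)
  have "inj_on (\<lambda>(x, xs). x # xs) (A \<times> tuples n A)" by (auto simp: inj_on_def)
  from sum.reindex[OF this, of "\<lambda>xs. prod_list (map w xs)"]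
  have "(\<Sum>xs\<in>tuples (Suc n) A. prod_list (map w xs)) = (\<Sum>(x, xs)\<in>A \<times> tuples n A. w x * prod_list (map w xs))"
    unfolding tuples_Suc by (simp add: split_beta comp_def)
  also have "\<dots> = (\<Sum>x\<in>A. w x) * (\<Sum>xs\<in>tuples n A. prod_list (map w xs))"
    by (simp add: sum_product sum.cartesian_product)
  finally show ?case using Suc by simp
qed

lemma prod_list_nonneg_real:
  fixes w :: "'a \<Rightarrow> real"
  shows "(\<And>x. x \<in> set xs \<Longrightarrow> 0 \<le> w x) \<Longrightarrow> 0 \<le> prod_list (map w xs)"
  by (induction xs) auto

lemma prod_list_pos_real:
  fixes w :: "'a \<Rightarrow> real"
  shows "(\<And>x. x \<in> set xs \<Longrightarrow> 0 < w x) \<Longrightarrow> 0 < prod_list (map w xs)"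
  by (induction xs) auto

text \<open>Pairs are grouped by their common value under \<open>r\<close>. When
  \<open>D \<kappa>\<close> is the mass of the fibre over \<kappa>, the summand is the weight of a
  pair drawn conditionally independently given \<open>r\<close>.\<close>

lemma sum_fibre_pairs:
  fixes p :: "'a \<Rightarrow> real"
  assumes "finite A"
  shows "(\<Sum>(a, b)\<in>{(a, b)\<in>A \<times> A. r a = r b}. p a * p b / D (r a))
    = (\<Sum>\<kappa>\<in>r ` A. (\<Sum>a\<in>{a\<in>A. r a = \<kappa>}. p a)\<^sup>2 / D \<kappa>)"
proof -
  let ?P = "{(a, b)\<in>A \<times> A. r a = r b}"
  have "finite ?P" by (rule finite_subset[of _ "A \<times> A"]) (use assms in auto)
  then have "(\<Sum>(a, b)\<in>?P. p a * p b / D (r a))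
      = (\<Sum>\<kappa>\<in>r ` A. \<Sum>x\<in>{x\<in>?P. r (fst x) = \<kappa>}. case x of (a, b) \<Rightarrow> p a * p b / D (r a))"
    by (intro sum.group[symmetric]) (use assms in auto)
  also have "\<dots> = (\<Sum>\<kappa>\<in>r ` A. (\<Sum>a\<in>{a\<in>A. r a = \<kappa>}. p a)\<^sup>2 / D \<kappa>)"
  proof (rule sum.cong[OF refl])
    fix \<kappa> assume "\<kappa> \<in> r ` A"
    have "{x\<in>?P. r (fst x) = \<kappa>} = {a\<in>A. r a = \<kappa>} \<times> {a\<in>A. r a = \<kappa>}" by auto
    then have "(\<Sum>x\<in>{x\<in>?P. r (fst x) = \<kappa>}. case x of (a, b) \<Rightarrow> p a * p b / D (r a))
        = (\<Sum>(a, b)\<in>{a\<in>A. r a = \<kappa>} \<times> {a\<in>A. r a = \<kappa>}. p a * p b / D \<kappa>)"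
      by (intro sum.cong) auto
    also have "\<dots> = (\<Sum>a\<in>{a\<in>A. r a = \<kappa>}. p a)\<^sup>2 / D \<kappa>"
      by (simp add: power2_eq_square sum_product sum.cartesian_product sum_divide_distrib split_beta)
    finally show "(\<Sum>x\<in>{x\<in>?P. r (fst x) = \<kappa>}. case x of (a, b) \<Rightarrow> p a * p b / D (r a))
        = (\<Sum>a\<in>{a\<in>A. r a = \<kappa>}. p a)\<^sup>2 / D \<kappa>" .
  qed
  finally show ?thesis .
qed

text \<open>Cauchy--Schwarz for \<open>x k / sqrt (D k)\<close> and
  \<open>sqrt (D k)\<close>.\<close>

lemma sum_squares_div_ge:
  fixes x D :: "'k \<Rightarrow> real"
  assumes D: "\<And>k. k \<in> I \<Longrightarrow> 0 < D k" "(\<Sum>k\<in>I. D k) \<le> 1"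
  shows "(\<Sum>k\<in>I. x k)\<^sup>2 \<le> (\<Sum>k\<in>I. (x k)\<^sup>2 / D k)"
proof -
  have "(\<Sum>k\<in>I. x k)\<^sup>2 = (\<Sum>k\<in>I. x k / sqrt (D k) * sqrt (D k))\<^sup>2"
    using D(1) by (intro arg_cong[where f = "\<lambda>t. t\<^sup>2"] sum.cong) (auto simp: less_imp_neq[THEN not_sym])
  also have "\<dots> \<le> (\<Sum>k\<in>I. (x k / sqrt (D k))\<^sup>2) * (\<Sum>k\<in>I. (sqrt (D k))\<^sup>2)"
    by (rule Cauchy_Schwarz_ineq_sum)
  also have "\<dots> = (\<Sum>k\<in>I. (x k)\<^sup>2 / D k) * (\<Sum>k\<in>I. D k)"
    using D(1) by (intro arg_cong2[where f = "(*)"] sum.cong) (auto simp: power_divide less_imp_le)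
  also have "\<dots> \<le> (\<Sum>k\<in>I. (x k)\<^sup>2 / D k)"
    by (rule mult_left_le[OF D(2)]) (use D(1) in \<open>auto intro!: sum_nonneg simp: less_imp_le\<close>)
  finally show ?thesis .
qed

text \<open>A second copy, conditionally independent given \<open>map r\<close>, squares the
  conditional probability of \<open>A\<close> in each fibre, and an average of squares is at least
  the square of the average. As the coordinates are independent,
  \<open>prod_list (map W \<kappa>s)\<close> is the mass of the fibre over
  \<open>\<kappa>s\<close>.\<close>

lemma sum_fibre_pairs_ge:
  fixes w :: "'a \<Rightarrow> real" and r :: "'a \<Rightarrow> 'k"
  assumes \<Omega>: "finite \<Omega>" "\<And>\<omega>. \<omega> \<in> \<Omega> \<Longrightarrow> 0 < w \<omega>" "(\<Sum>\<omega>\<in>\<Omega>. w \<omega>) = 1" and A: "A \<subseteq> tuples n \<Omega>"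
  defines "W \<equiv> \<lambda>\<kappa>. \<Sum>\<omega>\<in>{\<omega>\<in>\<Omega>. r \<omega> = \<kappa>}. w \<omega>"
  shows "(\<Sum>as\<in>A. prod_list (map w as))\<^sup>2 \<le>
    (\<Sum>(as, bs)\<in>{(as, bs)\<in>A \<times> A. map r as = map r bs}.
      prod_list (map w as) * prod_list (map w bs) / prod_list (map W (map r as)))"
proof -
  have Wpos: "0 < W \<kappa>" if "\<kappa> \<in> r ` \<Omega>" for \<kappa>
    unfolding W_def by (rule sum_pos) (use \<Omega> that in auto)
  have Wsum: "(\<Sum>\<kappa>\<in>r ` \<Omega>. W \<kappa>) = 1"
    unfolding W_def using \<Omega> by (subst sum.group) auto
  have finA: "finite A" using A finite_tuples[OF \<Omega>(1)] finite_subset by blast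
  let ?D = "\<lambda>\<kappa>s. prod_list (map W \<kappa>s)"
  have sub: "map r ` A \<subseteq> tuples n (r ` \<Omega>)" using A by (fastforce simp: tuples_def)
  have "(\<Sum>\<kappa>s\<in>map r ` A. ?D \<kappa>s) \<le> (\<Sum>\<kappa>s\<in>tuples n (r ` \<Omega>). ?D \<kappa>s)"
    by (rule sum_mono2[OF finite_tuples sub])
       (use \<Omega>(1) in \<open>auto intro!: prod_list_nonneg_real Wpos[THEN less_imp_le] simp: tuples_def\<close>)
  then have D1: "(\<Sum>\<kappa>s\<in>map r ` A. ?D \<kappa>s) \<le> 1"
    by (simp add: sum_tuples_prod_list Wsum)
  have Dpos: "0 < ?D \<kappa>s" if "\<kappa>s \<in> map r ` A" for \<kappa>s
    using that sub by (intro prod_list_pos_real Wpos) (auto simp: tuples_def)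
  have "(\<Sum>as\<in>A. prod_list (map w as)) =
      (\<Sum>\<kappa>s\<in>map r ` A. \<Sum>as\<in>{as\<in>A. map r as = \<kappa>s}. prod_list (map w as))"
    by (rule sum.group[symmetric]) (use finA in auto)
  also have "\<dots>\<^sup>2 \<le> (\<Sum>\<kappa>s\<in>map r ` A. (\<Sum>as\<in>{as\<in>A. map r as = \<kappa>s}. prod_list (map w as))\<^sup>2 / ?D \<kappa>s)"
    by (rule sum_squares_div_ge[OF Dpos D1])
  also have "\<dots> = (\<Sum>(as, bs)\<in>{(as, bs)\<in>A \<times> A. map r as = map r bs}.
      prod_list (map w as) * prod_list (map w bs) / ?D (map r as))"
    by (rule sum_fibre_pairs[OF finA, symmetric])
  finally show ?thesis .
qed

section \<open>Samplers: random homomorphisms with a density bound\<close>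

definition copy_in :: "(nat, nat) bigraph \<Rightarrow> (nat \<Rightarrow> nat \<Rightarrow> 'x) \<Rightarrow> (nat \<Rightarrow> nat \<Rightarrow> 'y) \<Rightarrow>
    ('x list \<times> 'y list) set \<Rightarrow> nat list \<Rightarrow> bool" where
  "copy_in H \<phi> \<psi> S \<omega>s \<longleftrightarrow> (\<forall>(a, b)\<in>edges H. (map (\<lambda>\<omega>. \<phi> \<omega> a) \<omega>s, map (\<lambda>\<omega>. \<psi> \<omega> b) \<omega>s) \<in> S)"

text \<open>A finite probability space whose points are pairs of vertex maps on \<open>H\<close>.
  Every homomorphism to \<open>Q\<close> occurs, hence with positive probability. The last clause is
  a Sidorenko-type bound for \<open>n\<close> independent draws, whose exponent \<open>K\<close>
  does not depend on \<open>n\<close>. Sample points are natural numbers so that the pairs arising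
  in a doubling can be encoded in the same type.\<close>

definition sampler :: "('x, 'y) bigraph \<Rightarrow> (nat, nat) bigraph \<Rightarrow> nat \<Rightarrow> nat set \<Rightarrow> (nat \<Rightarrow> real) \<Rightarrow>
    (nat \<Rightarrow> nat \<Rightarrow> 'x) \<Rightarrow> (nat \<Rightarrow> nat \<Rightarrow> 'y) \<Rightarrow> bool" where
  "sampler Q H K \<Omega> w \<phi> \<psi> \<longleftrightarrow>
     0 < K \<and> finite \<Omega> \<and> (\<forall>\<omega>\<in>\<Omega>. 0 < w \<omega>) \<and> (\<Sum>\<omega>\<in>\<Omega>. w \<omega>) = 1 \<and>
     (\<forall>f g. bigraph_hom H Q f g \<longrightarrow>
        (\<exists>\<omega>\<in>\<Omega>. (\<forall>a\<in>left H. \<phi> \<omega> a = f a) \<and> (\<forall>b\<in>right H. \<psi> \<omega> b = g b))) \<and>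
     (\<forall>n S. S \<subseteq> edges (bigraph_power n Q) \<longrightarrow>
        (card S / card (edges (bigraph_power n Q))) ^ K
          \<le> (\<Sum>\<omega>s | \<omega>s \<in> tuples n \<Omega> \<and> copy_in H \<phi> \<psi> S \<omega>s. prod_list (map w \<omega>s)))"

lemma sampler_hom:
  assumes "sampler Q H K \<Omega> w \<phi> \<psi>" "bigraph_hom H Q f g"
  obtains \<omega> where "\<omega> \<in> \<Omega>" "\<forall>a\<in>left H. \<phi> \<omega> a = f a" "\<forall>b\<in>right H. \<psi> \<omega> b = g b"
proof -
  have "\<exists>\<omega>\<in>\<Omega>. (\<forall>a\<in>left H. \<phi> \<omega> a = f a) \<and> (\<forall>b\<in>right H. \<psi> \<omega> b = g b)"
    using assms by (simp add: sampler_def)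
  then show ?thesis using that by blast
qed

lemma sampler_density:
  assumes "sampler Q H K \<Omega> w \<phi> \<psi>" "S \<subseteq> edges (bigraph_power n Q)"
  shows "(card S / card (edges (bigraph_power n Q))) ^ K
    \<le> (\<Sum>\<omega>s | \<omega>s \<in> tuples n \<Omega> \<and> copy_in H \<phi> \<psi> S \<omega>s. prod_list (map w \<omega>s))"
  using assms by (simp add: sampler_def)

lemma bigraph_hom_comp:
  assumes "bigraph_hom G H f g" "bigraph_hom H K f' g'"
  shows "bigraph_hom G K (f' \<circ> f) (g' \<circ> g)"
proof -
  have "(f' (f x), g' (g y)) \<in> edges K" if "(x, y) \<in> edges G" for x y
  proof -
    have "(f x, g y) \<in> edges H" using assms(1) that by (auto simp: bigraph_hom_def)
    then show ?thesis using assms(2) by (auto simp: bigraph_hom_def)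
  qed
  then show ?thesis using assms by (auto simp: bigraph_hom_def Pi_iff)
qed

lemma edges_bigraph_power:
  "edges (bigraph_power n Q) = (\<lambda>es. (map fst es, map snd es)) ` tuples n (edges Q)"
proof (intro equalityI subsetI)
  fix p assume "p \<in> edges (bigraph_power n Q)"
  then obtain xs ys where p: "p = (xs, ys)" "length xs = n" "length ys = n"
    "\<forall>i<n. (xs ! i, ys ! i) \<in> edges Q" by (auto simp: bigraph_power_def)
  then have "zip xs ys \<in> tuples n (edges Q)" by (auto simp: tuples_def set_zip)
  moreover have "p = (map fst (zip xs ys), map snd (zip xs ys))" using p by simp
  ultimately show "p \<in> (\<lambda>es. (map fst es, map snd es)) ` tuples n (edges Q)" by (rule rev_image_eqI)
next
  fix p assume "p \<in> (\<lambda>es. (map fst es, map snd es)) ` tuples n (edges Q)"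
  then show "p \<in> edges (bigraph_power n Q)"
    by (auto simp: bigraph_power_def tuples_def intro: nth_mem subsetD)
qed

lemma inj_map_fst_snd: "inj_on (\<lambda>es. (map fst es, map snd es)) A"
proof (rule inj_onI)
  fix x y :: "('a \<times> 'b) list"
  assume "(map fst x, map snd x) = (map fst y, map snd y)"
  then show "x = y" by (metis Pair_inject zip_map_fst_snd)
qed

lemma card_edges_bigraph_power:
  "finite (edges Q) \<Longrightarrow> card (edges (bigraph_power n Q)) = card (edges Q) ^ n"
  unfolding edges_bigraph_power card_image[OF inj_map_fst_snd]
  using card_lists_length_eq[of "edges Q" n] by (simp add: tuples_def conj_commute)

text \<open>A uniformly random edge, numbered by \<open>e\<close>. Its \<open>n\<close>-fold power
  is uniform on the edges of the power graph, so the probability of hitting \<open>S\<close> is the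
  density itself and the exponent is 1.\<close>

lemma sampler_single_edge:
  assumes fin: "finite (edges Q)" and ne: "edges Q \<noteq> {}"
  shows "\<exists>\<Omega> w \<phi> \<psi>. sampler Q \<lparr>left = {a}, right = {b}, edges = {(a, b)}\<rparr> 1 \<Omega> w \<phi> \<psi>"
proof -
  define c where "c = card (edges Q)"
  obtain e where e: "bij_betw e {..<c} (edges Q)"
    using ex_bij_betw_nat_finite[OF fin] unfolding c_def lessThan_atLeast0 by blast
  define d where "d = inv_into {..<c} e"
  have d: "d x \<in> {..<c}" "e (d x) = x" if "x \<in> edges Q" for x
    using e that unfolding d_def by (metis bij_betw_imp_surj_on inv_into_into, metis bij_betw_inv_into_right)
  have c: "0 < c" using fin ne by (simp add: c_def card_gt_0_iff)
  let ?H = "\<lparr>left = {a}, right = {b}, edges = {(a, b)}\<rparr>"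
  let ?\<phi> = "\<lambda>\<omega> (_::nat). fst (e \<omega>)" and ?\<psi> = "\<lambda>\<omega> (_::nat). snd (e \<omega>)" and ?w = "\<lambda>_::nat. 1 / real c"
  have hom: "\<exists>\<omega>\<in>{..<c}. (\<forall>a\<in>left ?H. ?\<phi> \<omega> a = f a) \<and> (\<forall>b\<in>right ?H. ?\<psi> \<omega> b = g b)"
    if "bigraph_hom ?H Q f g" for f g
    using that d[of "(f a, g b)"] by (intro bexI[of _ "d (f a, g b)"]) (auto simp: bigraph_hom_def)
  have dens: "(card S / card (edges (bigraph_power n Q))) ^ 1
      \<le> (\<Sum>\<omega>s | \<omega>s \<in> tuples n {..<c} \<and> copy_in ?H ?\<phi> ?\<psi> S \<omega>s. prod_list (map ?w \<omega>s))"
    if S: "S \<subseteq> edges (bigraph_power n Q)" for n S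
  proof -
    let ?T = "{\<omega>s. \<omega>s \<in> tuples n {..<c} \<and> copy_in ?H ?\<phi> ?\<psi> S \<omega>s}"
    have "finite ?T" using finite_tuples[of "{..<c}" n] by simp
    moreover have "S \<subseteq> (\<lambda>\<omega>s. (map (\<lambda>\<omega>. fst (e \<omega>)) \<omega>s, map (\<lambda>\<omega>. snd (e \<omega>)) \<omega>s)) ` ?T"
    proof
      fix s assume s: "s \<in> S"
      then obtain es where es: "s = (map fst es, map snd es)" "es \<in> tuples n (edges Q)"
        using S unfolding edges_bigraph_power by blast
      have eq: "map (\<lambda>\<omega>. fst (e \<omega>)) (map d es) = map fst es" "map (\<lambda>\<omega>. snd (e \<omega>)) (map d es) = map snd es"
        using es(2) d(2) by (auto simp: tuples_def)
      have "map d es \<in> tuples n {..<c}" using es(2) d(1) by (auto simp: tuples_def)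
      then have "map d es \<in> ?T" using s es(1) eq by (simp add: copy_in_def del: map_map)
      then show "s \<in> (\<lambda>\<omega>s. (map (\<lambda>\<omega>. fst (e \<omega>)) \<omega>s, map (\<lambda>\<omega>. snd (e \<omega>)) \<omega>s)) ` ?T"
        using es(1) eq by (intro rev_image_eqI) (auto simp del: map_map)
    qed
    ultimately have "card S \<le> card ?T" by (rule surj_card_le)
    then have "card S / real c ^ n \<le> card ?T / real c ^ n" by (simp add: divide_right_mono)
    also have "\<dots> = (\<Sum>\<omega>s\<in>?T. (1 / real c) ^ n)" by (simp add: power_one_over)
    also have "\<dots> = (\<Sum>\<omega>s\<in>?T. prod_list (map ?w \<omega>s))"
      by (rule sum.cong) (auto simp: tuples_def map_replicate_const)
    finally show ?thesis by (simp add: card_edges_bigraph_power[OF fin] c_def[symmetric])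
  qed
  have "sampler Q ?H 1 {..<c} ?w ?\<phi> ?\<psi>"
    unfolding sampler_def using c hom dens by simp
  then show ?thesis by blast
qed

text \<open>The same space works: the smaller graph has fewer edges to place in \<open>S\<close>,
  and a homomorphism from it extends to \<open>H\<close> by composition with the retraction.\<close>

lemma sampler_collapse:
  assumes s: "sampler Q H K \<Omega> w \<phi> \<psi>" and sub: "X\<^sub>0 \<subseteq> left H" "Y\<^sub>0 \<subseteq> right H"
    and hom: "bigraph_hom H (induced_bigraph H X\<^sub>0 Y\<^sub>0) f g" and id: "\<forall>x\<in>X\<^sub>0. f x = x" "\<forall>y\<in>Y\<^sub>0. g y = y"
  shows "sampler Q (induced_bigraph H X\<^sub>0 Y\<^sub>0) K \<Omega> w \<phi> \<psi>"
proof -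
  let ?H = "induced_bigraph H X\<^sub>0 Y\<^sub>0"
  have fin: "finite \<Omega>" and w: "\<forall>\<omega>\<in>\<Omega>. 0 < w \<omega>" using s by (auto simp: sampler_def)
  have "\<exists>\<omega>\<in>\<Omega>. (\<forall>a\<in>left ?H. \<phi> \<omega> a = f' a) \<and> (\<forall>b\<in>right ?H. \<psi> \<omega> b = g' b)"
    if "bigraph_hom ?H Q f' g'" for f' g'
  proof -
    have "bigraph_hom H Q (f' \<circ> f) (g' \<circ> g)"
      by (rule bigraph_hom_comp[OF hom that])
    then obtain \<omega> where "\<omega> \<in> \<Omega>" "\<forall>a\<in>left H. \<phi> \<omega> a = (f' \<circ> f) a"
      "\<forall>b\<in>right H. \<psi> \<omega> b = (g' \<circ> g) b"
      by (rule sampler_hom[OF s])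
    then show ?thesis using sub id by (intro bexI[of _ \<omega>]) (auto simp: induced_bigraph_def subset_iff)
  qed
  moreover
  have "(\<Sum>\<omega>s | \<omega>s \<in> tuples n \<Omega> \<and> copy_in H \<phi> \<psi> S \<omega>s. prod_list (map w \<omega>s))
      \<le> (\<Sum>\<omega>s | \<omega>s \<in> tuples n \<Omega> \<and> copy_in ?H \<phi> \<psi> S \<omega>s. prod_list (map w \<omega>s))" for n S
  proof (rule sum_mono2)
    show "finite {\<omega>s. \<omega>s \<in> tuples n \<Omega> \<and> copy_in ?H \<phi> \<psi> S \<omega>s}" using finite_tuples[OF fin] by simp
    show "{\<omega>s. \<omega>s \<in> tuples n \<Omega> \<and> copy_in H \<phi> \<psi> S \<omega>s} \<subseteq> {\<omega>s. \<omega>s \<in> tuples n \<Omega> \<and> copy_in ?H \<phi> \<psi> S \<omega>s}"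
      by (auto simp: copy_in_def induced_bigraph_def)
  qed (use w in \<open>auto simp: tuples_def subset_iff less_imp_le intro!: prod_list_nonneg_real\<close>)
  note mono = order_trans[OF sampler_density[OF s] this]
  ultimately show ?thesis using s mono by (simp add: sampler_def)
qed

lemma sampler_renaming:
  assumes s: "sampler Q H K \<Omega> w \<phi> \<psi>" and H: "finite_bigraph H" and iso: "bigraph_iso H H'"
  shows "\<exists>\<phi>' \<psi>'. sampler Q H' K \<Omega> w \<phi>' \<psi>'"
proof -
  obtain f g where f: "bij_betw f (left H) (left H')" and g: "bij_betw g (right H) (right H')"
    and E: "edges H' = map_prod f g ` edges H" using iso unfolding bigraph_iso_def by blast
  define \<phi>' where "\<phi>' \<omega> x = \<phi> \<omega> (inv_into (left H) f x)" for \<omega> x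
  define \<psi>' where "\<psi>' \<omega> y = \<psi> \<omega> (inv_into (right H) g y)" for \<omega> y
  have inv: "inv_into (left H) f (f x) = x" if "x \<in> left H" for x
    using f that by (simp add: bij_betw_inv_into_left)
  have inv': "inv_into (right H) g (g y) = y" if "y \<in> right H" for y
    using g that by (simp add: bij_betw_inv_into_left)
  have im: "left H' = f ` left H" "right H' = g ` right H" using f g by (auto simp: bij_betw_def)
  have EH: "edges H \<subseteq> left H \<times> right H" using H by (simp add: finite_bigraph_def)
  have copy: "copy_in H' \<phi>' \<psi>' S \<omega>s \<longleftrightarrow> copy_in H \<phi> \<psi> S \<omega>s" for S \<omega>s
  proof -
    have "(\<phi>' \<omega> (f a) = \<phi> \<omega> a) \<and> (\<psi>' \<omega> (g b) = \<psi> \<omega> b)" if "(a, b) \<in> edges H" for \<omega> a b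
      using EH that inv inv' by (auto simp: \<phi>'_def \<psi>'_def)
    then show ?thesis unfolding copy_in_def E by (auto simp: split_beta)
  qed
  have "\<exists>\<omega>\<in>\<Omega>. (\<forall>a\<in>left H'. \<phi>' \<omega> a = f' a) \<and> (\<forall>b\<in>right H'. \<psi>' \<omega> b = g' b)"
    if "bigraph_hom H' Q f' g'" for f' g'
  proof -
    have "bigraph_hom H H' f g" by (auto simp: bigraph_hom_def E im)
    from bigraph_hom_comp[OF this that]
    obtain \<omega> where "\<omega> \<in> \<Omega>" "\<forall>a\<in>left H. \<phi> \<omega> a = (f' \<circ> f) a"
      "\<forall>b\<in>right H. \<psi> \<omega> b = (g' \<circ> g) b"
      by (rule sampler_hom[OF s])
    then show ?thesis by (intro bexI[of _ \<omega>]) (auto simp: im \<phi>'_def \<psi>'_def inv inv')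
  qed
  then have "sampler Q H' K \<Omega> w \<phi>' \<psi>'"
    using s unfolding sampler_def copy by simp
  then show ?thesis by blast
qed

text \<open>Two points of \<Omega> are drawn conditionally independently given the values at the
  fixed vertices; the first supplies the maps on \<open>H\<close>, the second those on the copies.
  The bound for conditionally independent pairs squares the probability and so doubles the
  exponent.\<close>

lemma sampler_doubling:
  assumes s: "sampler Q H K \<Omega> w \<phi> \<psi>" and H: "finite_bigraph H"
    and F: "FX \<subseteq> left H" "FY \<subseteq> right H"
    and c: "inj_on c (left H - FX)" "c ` (left H - FX) \<inter> left H = {}"
    and d: "inj_on d (right H - FY)" "d ` (right H - FY) \<inter> right H = {}"
  shows "\<exists>\<Omega>' w' \<phi>' \<psi>'. sampler Q (double_bigraph H FX FY c d) (K * 2) \<Omega>' w' \<phi>' \<psi>'"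
proof -
  have K: "0 < K" and fin: "finite \<Omega>" and w: "\<And>\<omega>. \<omega> \<in> \<Omega> \<Longrightarrow> 0 < w \<omega>" and sum1: "(\<Sum>\<omega>\<in>\<Omega>. w \<omega>) = 1"
    using s by (auto simp: sampler_def)
  have EH: "edges H \<subseteq> left H \<times> right H" using H by (simp add: finite_bigraph_def)
  let ?H = "double_bigraph H FX FY c d"
  \<comment> \<open>The data conditioned on. \<open>restrict\<close> gives one default value off the
    fixed sets, so equality under \<open>r\<close> means agreement on the fixed vertices.\<close>
  define r where "r \<omega> = (restrict (\<phi> \<omega>) FX, restrict (\<psi> \<omega>) FY)" for \<omega>
  define W where "W = (\<lambda>\<kappa>. \<Sum>\<omega>\<in>{\<omega>\<in>\<Omega>. r \<omega> = \<kappa>}. w \<omega>)"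
  define p where "p m = fst (prod_decode m)" for m
  define q where "q m = snd (prod_decode m)" for m
  have pq: "p (prod_encode x) = fst x" "q (prod_encode x) = snd x" for x
    by (simp_all add: p_def q_def)
  define P where "P = {(a, b)\<in>\<Omega> \<times> \<Omega>. r a = r b}"
  define \<Omega>' where "\<Omega>' = prod_encode ` P"
  \<comment> \<open>Conditional independence: the product of the weights divided by the mass of the
    common fibre.\<close>
  define w' where "w' m = w (p m) * w (q m) / W (r (p m))" for m
  define \<phi>' where "\<phi>' m x = (if x \<in> left H then \<phi> (p m) x else \<phi> (q m) (inv_into (left H - FX) c x))" for m x
  define \<psi>' where "\<psi>' m y = (if y \<in> right H then \<psi> (p m) y else \<psi> (q m) (inv_into (right H - FY) d y))" for m y
  define cx where "cx x = (if x \<in> FX then x else c x)" for x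
  define dy where "dy y = (if y \<in> FY then y else d y)" for y
  have left: "left ?H = left H \<union> cx ` left H" and right: "right ?H = right H \<union> dy ` right H"
    using F by (auto simp: double_bigraph_def cx_def dy_def)
  have edges: "edges ?H = edges H \<union> (\<lambda>(x, y). (cx x, dy y)) ` edges H"
  proof (intro equalityI subsetI)
    fix e assume "e \<in> edges ?H"
    then consider "e \<in> edges H" | x y where "(x, y) \<in> edges H" "e = (cx x, dy y)"
      unfolding double_bigraph_def cx_def dy_def by auto
    then show "e \<in> edges H \<union> (\<lambda>(x, y). (cx x, dy y)) ` edges H"
      by cases (auto intro: rev_image_eqI)
  next
    fix e assume "e \<in> edges H \<union> (\<lambda>(x, y). (cx x, dy y)) ` edges H"
    then consider "e \<in> edges H" | x y where "(x, y) \<in> edges H" "e = (cx x, dy y)" by auto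
    then show "e \<in> edges ?H"
    proof cases
      case 1
      then show ?thesis by (simp add: double_bigraph_def)
    next
      case 2
      show ?thesis
      proof (cases "x \<in> FX \<and> y \<in> FY")
        case True
        then show ?thesis using 2 by (simp add: double_bigraph_def cx_def dy_def)
      next
        case False
        then show ?thesis using 2 unfolding double_bigraph_def cx_def dy_def by simp blast
      qed
    qed
  qed
  have r_eq: "r a = r b \<longleftrightarrow> (\<forall>x\<in>FX. \<phi> a x = \<phi> b x) \<and> (\<forall>y\<in>FY. \<psi> a y = \<psi> b y)" for a b
    unfolding r_def by (auto simp: restrict_def fun_eq_iff)
  have \<phi>'1: "\<phi>' m x = \<phi> (p m) x" if "x \<in> left H" for m x using that by (simp add: \<phi>'_def)
  have \<psi>'1: "\<psi>' m y = \<psi> (p m) y" if "y \<in> right H" for m y using that by (simp add: \<psi>'_def)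
  have \<phi>'2: "\<phi>' m (cx x) = \<phi> (q m) x" if "x \<in> left H" "r (p m) = r (q m)" for m x
  proof (cases "x \<in> FX")
    case True
    then show ?thesis using that by (simp add: \<phi>'_def cx_def r_eq)
  next
    case False
    then have "x \<in> left H - FX" using that by simp
    moreover from this have "c x \<notin> left H" using c(2) by blast
    ultimately show ?thesis using False c(1) by (simp add: \<phi>'_def cx_def inv_into_f_f)
  qed
  have \<psi>'2: "\<psi>' m (dy y) = \<psi> (q m) y" if "y \<in> right H" "r (p m) = r (q m)" for m y
  proof (cases "y \<in> FY")
    case True
    then show ?thesis using that by (simp add: \<psi>'_def dy_def r_eq)
  next
    case False
    then have "y \<in> right H - FY" using that by simp
    moreover from this have "d y \<notin> right H" using d(2) by blast
    ultimately show ?thesis using False d(1) by (simp add: \<psi>'_def dy_def inv_into_f_f)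
  qed
  have \<Omega>': "p m \<in> \<Omega>" "q m \<in> \<Omega>" "r (p m) = r (q m)" if "m \<in> \<Omega>'" for m
    using that by (auto simp: \<Omega>'_def P_def pq)
  have finP: "finite P" by (rule finite_subset[of _ "\<Omega> \<times> \<Omega>"]) (use fin in \<open>auto simp: P_def\<close>)
  then have fin': "finite \<Omega>'" by (simp add: \<Omega>'_def)
  have Wpos: "0 < W (r \<omega>)" if "\<omega> \<in> \<Omega>" for \<omega>
    unfolding W_def by (rule sum_pos) (use fin w that in auto)
  have w'pos: "0 < w' m" if "m \<in> \<Omega>'" for m
    unfolding w'_def using \<Omega>'[OF that] w Wpos by simp
  have sum': "(\<Sum>m\<in>\<Omega>'. w' m) = 1"
  proof -
    have "(\<Sum>m\<in>\<Omega>'. w' m) = (\<Sum>(a, b)\<in>P. w a * w b / W (r a))"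
      unfolding \<Omega>'_def by (subst sum.reindex) (auto simp: w'_def pq comp_def split_beta inj_prod_encode)
    also have "\<dots> = (\<Sum>\<kappa>\<in>r ` \<Omega>. (W \<kappa>)\<^sup>2 / W \<kappa>)"
      unfolding P_def W_def by (rule sum_fibre_pairs[OF fin])
    also have "\<dots> = (\<Sum>\<kappa>\<in>r ` \<Omega>. W \<kappa>)"
      by (rule sum.cong) (auto simp: power2_eq_square)
    also have "\<dots> = 1"
      unfolding W_def using fin sum1 by (subst sum.group) auto
    finally show ?thesis .
  qed
  \<comment> \<open>A homomorphism of the doubled graph amounts to two homomorphisms of
    \<open>H\<close> agreeing on the fixed vertices: its restriction and its composite with the
    copying map.\<close>
  have hom: "\<exists>m\<in>\<Omega>'. (\<forall>a\<in>left ?H. \<phi>' m a = f a) \<and> (\<forall>b\<in>right ?H. \<psi>' m b = g b)"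
    if fg: "bigraph_hom ?H Q f g" for f g
  proof -
    have "bigraph_hom H Q f g"
      using fg by (auto simp: bigraph_hom_def left right edges)
    then obtain a where a: "a \<in> \<Omega>" "\<forall>x\<in>left H. \<phi> a x = f x" "\<forall>y\<in>right H. \<psi> a y = g y"
      by (rule sampler_hom[OF s])
    have "bigraph_hom H ?H cx dy"
      unfolding bigraph_hom_def left right edges by force
    from bigraph_hom_comp[OF this fg]
    obtain b where b: "b \<in> \<Omega>" "\<forall>x\<in>left H. \<phi> b x = (f \<circ> cx) x" "\<forall>y\<in>right H. \<psi> b y = (g \<circ> dy) y"
      by (rule sampler_hom[OF s])
    have ab: "r a = r b"
      unfolding r_eq using a b F by (auto simp: cx_def dy_def subset_iff)
    define m where "m = prod_encode (a, b)"
    have m: "m \<in> \<Omega>'" "p m = a" "q m = b"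
      using a b ab by (auto simp: m_def \<Omega>'_def P_def pq)
    have "\<phi>' m x = f x" if "x \<in> left ?H" for x
      using that \<phi>'1 \<phi>'2 m a b ab unfolding left by auto
    moreover have "\<psi>' m y = g y" if "y \<in> right ?H" for y
      using that \<psi>'1 \<psi>'2 m a b ab unfolding right by auto
    ultimately show ?thesis using m(1) by blast
  qed
  have dens: "(card S / card (edges (bigraph_power n Q))) ^ (K * 2)
      \<le> (\<Sum>ms | ms \<in> tuples n \<Omega>' \<and> copy_in ?H \<phi>' \<psi>' S ms. prod_list (map w' ms))"
    if S: "S \<subseteq> edges (bigraph_power n Q)" for n S
  proof -
    define A where "A = {\<omega>s. \<omega>s \<in> tuples n \<Omega> \<and> copy_in H \<phi> \<psi> S \<omega>s}"
    let ?B = "{ms. ms \<in> tuples n \<Omega>' \<and> copy_in ?H \<phi>' \<psi>' S ms}"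
    let ?P = "{(as, bs)\<in>A \<times> A. map r as = map r bs}"
    let ?e = "\<lambda>(as, bs). map prod_encode (zip as bs)"
    have zip: "map p (?e (as, bs)) = as" "map q (?e (as, bs)) = bs" if "(as, bs) \<in> ?P" for as bs
    proof -
      have "length as = length bs" using that by (auto simp: A_def tuples_def)
      then show "map p (?e (as, bs)) = as" "map q (?e (as, bs)) = bs"
        by (simp_all add: p_def q_def comp_def)
    qed
    have inj: "inj_on ?e ?P"
      by (rule inj_on_inverseI[where g = "\<lambda>ms. (map p ms, map q ms)"]) (use zip in auto)
    have prod: "prod_list (map w' ms) = prod_list (map w (map p ms)) * prod_list (map w (map q ms))
        / prod_list (map W (map r (map p ms)))" for ms
      by (induction ms) (auto simp: w'_def)
    \<comment> \<open>Two lists of draws that agree on the fixed vertices in every coordinate, and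
      that both place \<open>H\<close> in \<open>S\<close>, combine to a list placing the doubled
      graph in \<open>S\<close>, as each of its edges comes from one of the two copies.\<close>
    have sub: "?e ` ?P \<subseteq> ?B"
    proof
      fix ms assume "ms \<in> ?e ` ?P"
      then obtain as bs where ab: "(as, bs) \<in> ?P" and ms: "ms = ?e (as, bs)" by blast
      have pm: "map p ms = as" and qm: "map q ms = bs" using zip[OF ab] ms by auto
      have A: "as \<in> A" "bs \<in> A" "map r as = map r bs" using ab by auto
      have mr: "r (p m) = r (q m)" if "m \<in> set ms" for m
        using A(3) that unfolding pm[symmetric] qm[symmetric] by simp
      have "m \<in> \<Omega>'" if "m \<in> set ms" for m
      proof -
        have "p m \<in> set as" "q m \<in> set bs" using that pm qm by auto
        then have "(p m, q m) \<in> P" using A mr[OF that] by (auto simp: P_def A_def tuples_def)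
        moreover have "m = prod_encode (p m, q m)" by (simp add: p_def q_def)
        ultimately show ?thesis unfolding \<Omega>'_def by (metis imageI)
      qed
      moreover have "length ms = n" using A(1) pm by (auto simp: A_def tuples_def)
      moreover have "(map (\<lambda>m. \<phi>' m x) ms, map (\<lambda>m. \<psi>' m y) ms) \<in> S" if "(x, y) \<in> edges ?H" for x y
      proof -
        from that consider "(x, y) \<in> edges H" | x' y' where "(x', y') \<in> edges H" "x = cx x'" "y = dy y'"
          unfolding edges by auto
        then show ?thesis
        proof cases
          case 1
          then have "map (\<lambda>m. \<phi>' m x) ms = map (\<lambda>\<omega>. \<phi> \<omega> x) as" "map (\<lambda>m. \<psi>' m y) ms = map (\<lambda>\<omega>. \<psi> \<omega> y) as"
            using EH \<phi>'1 \<psi>'1 unfolding pm[symmetric] by auto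
          then show ?thesis using A(1) 1 by (auto simp: A_def copy_in_def)
        next
          case 2
          then have "map (\<lambda>m. \<phi>' m x) ms = map (\<lambda>\<omega>. \<phi> \<omega> x') bs" "map (\<lambda>m. \<psi>' m y) ms = map (\<lambda>\<omega>. \<psi> \<omega> y') bs"
            using EH \<phi>'2 \<psi>'2 mr unfolding qm[symmetric] by auto
          then show ?thesis using A(2) 2 by (auto simp: A_def copy_in_def)
        qed
      qed
      ultimately show "ms \<in> ?B" by (auto simp: tuples_def copy_in_def)
    qed
    have "(card S / card (edges (bigraph_power n Q))) ^ (K * 2)
        = ((card S / card (edges (bigraph_power n Q))) ^ K)\<^sup>2" by (simp add: power_mult)
    also have "\<dots> \<le> (\<Sum>as\<in>A. prod_list (map w as))\<^sup>2"
      by (rule power_mono) (use sampler_density[OF s S] in \<open>auto simp: A_def\<close>)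
    also have "\<dots> \<le> (\<Sum>(as, bs)\<in>?P. prod_list (map w as) * prod_list (map w bs) / prod_list (map W (map r as)))"
      unfolding W_def by (rule sum_fibre_pairs_ge[OF fin w sum1]) (auto simp: A_def)
    also have "\<dots> = (\<Sum>x\<in>?P. prod_list (map w' (?e x)))"
    proof (rule sum.cong[OF refl])
      fix x assume x: "x \<in> ?P"
      obtain as bs where ab: "x = (as, bs)" by fastforce
      show "(case x of (as, bs) \<Rightarrow> prod_list (map w as) * prod_list (map w bs) / prod_list (map W (map r as)))
          = prod_list (map w' (?e x))"
        using zip[of as bs] x unfolding ab prod by (simp del: map_map)
    qed
    also have "\<dots> = (\<Sum>ms\<in>?e ` ?P. prod_list (map w' ms))"
      by (subst sum.reindex[OF inj]) (simp add: comp_def)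
    also have "\<dots> \<le> (\<Sum>ms\<in>?B. prod_list (map w' ms))"
    proof (rule sum_mono2[OF _ sub])
      show "finite ?B" using finite_tuples[OF fin'] by simp
    qed (use w'pos in \<open>auto simp: tuples_def subset_iff less_imp_le intro!: prod_list_nonneg_real\<close>)
    finally show ?thesis .
  qed
  have "sampler Q ?H (K * 2) \<Omega>' w' \<phi>' \<psi>'"
    unfolding sampler_def using K fin' w'pos sum' hom dens by simp
  then show ?thesis by blast
qed

lemma constructible_nat_sampler:
  assumes H: "constructible_nat H" and Q: "finite (edges Q)" "edges Q \<noteq> {}"
  shows "\<exists>K \<Omega> w \<phi> \<psi>. sampler Q H K \<Omega> w \<phi> \<psi>"
  using H
proof (induction rule: constructible_nat.induct)
  case (single_edge a b)
  show ?case using sampler_single_edge[OF Q] by blast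
next
  case (doubling H FX FY c d)
  then obtain K \<Omega> w \<phi> \<psi> where "sampler Q H K \<Omega> w \<phi> \<psi>" by blast
  from sampler_doubling[OF this _ doubling.hyps(2-)] show ?case
    using constructible_nat_wf[OF doubling.hyps(1)] by blast
next
  case (collapse H X\<^sub>0 Y\<^sub>0 f g)
  then obtain K \<Omega> w \<phi> \<psi> where "sampler Q H K \<Omega> w \<phi> \<psi>" by blast
  from sampler_collapse[OF this collapse.hyps(2-)] show ?case by blast
next
  case (renaming H H')
  then obtain K \<Omega> w \<phi> \<psi> where "sampler Q H K \<Omega> w \<phi> \<psi>" by blast
  from sampler_renaming[OF this _ renaming.hyps(2)] show ?case
    using constructible_nat_wf[OF renaming.hyps(1)] by blast
qed

section \<open>Parallel repetition\<close>

lemma winning_prob_eq: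
  assumes "finite_game \<G>"
  shows "winning_prob \<G> s t = card {(x, y)\<in>edges (question_set \<G>). accepts \<G> (x, y) (s x) (t y)}
    / card (edges (question_set \<G>))"
proof -
  let ?E = "edges (question_set \<G>)"
  have "finite ?E" "?E \<noteq> {}"
    using assms finite_subset[OF _ finite_cartesian_product] by (auto simp: finite_game_def finite_bigraph_def)
  moreover have "?E \<inter> {(x, y). accepts \<G> (x, y) (s x) (t y)} = {(x, y)\<in>?E. accepts \<G> (x, y) (s x) (t y)}"
    by auto
  ultimately show ?thesis unfolding winning_prob_def by (simp add: measure_pmf_of_set)
qed

text \<open>This makes the \<open>Max\<close> in \<open>game_value\<close> a true maximum.
  Strategies are extensional functions, so there are only finitely many.\<close>

lemma strategy_values:
  assumes "finite_game \<G>"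
  defines "V \<equiv> {winning_prob \<G> s t | s t. s \<in> left (question_set \<G>) \<rightarrow>\<^sub>E answers1 \<G> \<and>
            t \<in> right (question_set \<G>) \<rightarrow>\<^sub>E answers2 \<G>}"
  shows "finite V" "V \<noteq> {}"
proof -
  let ?L = "left (question_set \<G>) \<rightarrow>\<^sub>E answers1 \<G>" and ?R = "right (question_set \<G>) \<rightarrow>\<^sub>E answers2 \<G>"
  have V: "V = (\<lambda>(s, t). winning_prob \<G> s t) ` (?L \<times> ?R)" by (auto simp: V_def)
  have "finite ?L" "finite ?R" "?L \<noteq> {}" "?R \<noteq> {}"
    using assms(1) by (auto simp: finite_game_def finite_bigraph_def PiE_eq_empty_iff intro!: finite_PiE)
  then show "finite V" "V \<noteq> {}" unfolding V by auto
qed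

lemma game_value_le:
  assumes "finite_game \<G>"
    and "\<And>s t. s \<in> left (question_set \<G>) \<rightarrow>\<^sub>E answers1 \<G> \<Longrightarrow>
           t \<in> right (question_set \<G>) \<rightarrow>\<^sub>E answers2 \<G> \<Longrightarrow> winning_prob \<G> s t \<le> v"
  shows "game_value \<G> \<le> v"
  unfolding game_value_def using strategy_values[OF assms(1)] assms(2) by (intro Max.boundedI) auto

lemma trivial_game_if_perfect:
  assumes \<G>: "finite_game \<G>" and s: "s \<in> left (question_set \<G>) \<rightarrow>\<^sub>E answers1 \<G>"
    and t: "t \<in> right (question_set \<G>) \<rightarrow>\<^sub>E answers2 \<G>"
    and acc: "\<And>x y. (x, y) \<in> edges (question_set \<G>) \<Longrightarrow> accepts \<G> (x, y) (s x) (t y)"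
  shows "trivial_game \<G>"
proof -
  let ?E = "edges (question_set \<G>)"
  have E: "finite ?E" "?E \<noteq> {}"
    using \<G> finite_subset[OF _ finite_cartesian_product] by (auto simp: finite_game_def finite_bigraph_def)
  have "{(x, y)\<in>?E. accepts \<G> (x, y) (s x) (t y)} = ?E" using acc by auto
  then have "winning_prob \<G> s t = 1" using E by (simp add: winning_prob_eq[OF \<G>] card_gt_0_iff)
  then have "1 \<le> game_value \<G>"
    unfolding game_value_def using strategy_values(1)[OF \<G>] s t by (intro Max_ge) auto
  moreover have "game_value \<G> \<le> 1"
    by (rule game_value_le[OF \<G>]) (simp add: winning_prob_def)
  ultimately show ?thesis by (simp add: trivial_game_def)
qed

lemma tuples_nonempty: "A \<noteq> {} \<Longrightarrow> tuples n A \<noteq> {}"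
proof -
  assume "A \<noteq> {}"
  then obtain x where "x \<in> A" by blast
  then have "replicate n x \<in> tuples n A" by (auto simp: tuples_def)
  then show ?thesis by blast
qed

lemma finite_game_parallel_repetition:
  assumes "finite_game \<G>"
  shows "finite_game (parallel_repetition n \<G>)"
proof -
  let ?Q = "question_set \<G>"
  have "edges (bigraph_power n ?Q) \<subseteq> left (bigraph_power n ?Q) \<times> right (bigraph_power n ?Q)"
    using assms unfolding edges_bigraph_power finite_game_def finite_bigraph_def
    by (fastforce simp: bigraph_power_def tuples_def)
  moreover have "edges (bigraph_power n ?Q) \<noteq> {}"
  proof -
    have "tuples n (edges ?Q) \<noteq> {}" using assms by (simp add: tuples_nonempty finite_game_def)
    then show ?thesis unfolding edges_bigraph_power by blast
  qed
  ultimately show ?thesis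
    using assms by (auto simp: finite_game_def finite_bigraph_def parallel_repetition_def
        bigraph_power_def finite_tuples tuples_nonempty)
qed

theorem exponential_parallel_repetition_if_constructible:
  assumes con: "constructible_by_conditioning Q" and Q: "finite_bigraph Q"
  shows "exponential_parallel_repetition Q"
proof -
  obtain H where H: "constructible_nat H" and "bigraph_iso H Q"
    using con unfolding constructible_by_conditioning_def by blast
  then obtain f g where f: "bij_betw f (left H) (left Q)" and g: "bij_betw g (right H) (right Q)"
    and E: "edges Q = map_prod f g ` edges H" unfolding bigraph_iso_def by blast
  have im: "left Q = f ` left H" "right Q = g ` right H" using f g by (auto simp: bij_betw_def)
  have wfH: "edges H \<subseteq> left H \<times> right H" "edges H \<noteq> {}" "no_isolated_vertices H"
    using constructible_nat_wf[OF H] by (auto simp: finite_bigraph_def)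
  have finE: "finite (edges Q)" and neE: "edges Q \<noteq> {}"
    using Q finite_subset[OF _ finite_cartesian_product] wfH(2) E by (auto simp: finite_bigraph_def)
  obtain K \<Omega> w \<phi> \<psi> where s: "sampler Q H K \<Omega> w \<phi> \<psi>"
    using constructible_nat_sampler[OF H finE neE] by blast
  have K: "0 < K" and fin: "finite \<Omega>" and w: "\<And>\<omega>. \<omega> \<in> \<Omega> \<Longrightarrow> 0 < w \<omega>" and sum1: "(\<Sum>\<omega>\<in>\<Omega>. w \<omega>) = 1"
    using s by (auto simp: sampler_def)
  \<comment> \<open>The isomorphism is itself a homomorphism, so it occurs as a sample point
    \<open>\<omega>\<^sub>0\<close> of positive weight.\<close>
  have "bigraph_hom H Q f g" by (auto simp: bigraph_hom_def E im)
  then obtain \<omega>\<^sub>0 where \<omega>0: "\<omega>\<^sub>0 \<in> \<Omega>" "\<forall>a\<in>left H. \<phi> \<omega>\<^sub>0 a = f a" "\<forall>b\<in>right H. \<psi> \<omega>\<^sub>0 b = g b"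
    by (rule sampler_hom[OF s])
  define finv where "finv = inv_into (left H) f"
  define ginv where "ginv = inv_into (right H) g"
  have finv: "finv x \<in> left H" "f (finv x) = x" if "x \<in> left Q" for x
    using that unfolding finv_def im(1) by (auto intro: inv_into_into f_inv_into_f)
  have ginv: "ginv y \<in> right H" "g (ginv y) = y" if "y \<in> right Q" for y
    using that unfolding ginv_def im(2) by (auto intro: inv_into_into f_inv_into_f)
  have inv_edge: "(finv x, ginv y) \<in> edges H" if xy: "(x, y) \<in> edges Q" for x y
  proof -
    obtain a b where ab: "(a, b) \<in> edges H" "x = f a" "y = g b" using xy unfolding E by auto
    then have "finv x = a" "ginv y = b"
      using wfH(1) f g unfolding finv_def ginv_def by (auto simp: bij_betw_inv_into_left)
    then show ?thesis using ab by simp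
  qed
  \<comment> \<open>The probability that a single draw misses
    \<open>\<omega>\<^sub>0\<close>.\<close>
  define D where "D = 1 - w \<omega>\<^sub>0"
  have D: "D = (\<Sum>\<omega>\<in>\<Omega> - {\<omega>\<^sub>0}. w \<omega>)"
    unfolding D_def using fin \<omega>0(1) sum1 by (simp add: sum_diff1)
  then have D0: "0 \<le> D" using w by (auto intro!: sum_nonneg simp: less_imp_le)
  have D1: "D < 1" using w[OF \<omega>0(1)] by (simp add: D_def)
  \<comment> \<open>The root undoes the exponent \<open>K\<close> of the density bound, so that
    \<open>C ^ n\<close> bounds the winning density itself.\<close>
  define C where "C = root K D"
  have C1: "C < 1" using K D1 by (simp add: C_def)
  have bound: "game_value (parallel_repetition n \<G>) \<le> C ^ n"
    if \<G>: "finite_game \<G>" "question_set \<G> = Q" "\<not> trivial_game \<G>" for n and \<G> :: "('a, 'b, 'c, 'd) game"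
  proof (rule game_value_le[OF finite_game_parallel_repetition[OF \<G>(1)]])
    fix s\<^sub>1 s\<^sub>2
    let ?R = "parallel_repetition n \<G>"
    assume s1: "s\<^sub>1 \<in> left (question_set ?R) \<rightarrow>\<^sub>E answers1 ?R"
      and s2: "s\<^sub>2 \<in> right (question_set ?R) \<rightarrow>\<^sub>E answers2 ?R"
    define S where "S = {(xs, ys)\<in>edges (bigraph_power n Q). accepts ?R (xs, ys) (s\<^sub>1 xs) (s\<^sub>2 ys)}"
    let ?En = "edges (bigraph_power n Q)"
    have prob: "winning_prob ?R s\<^sub>1 s\<^sub>2 = card S / card ?En"
      unfolding winning_prob_eq[OF finite_game_parallel_repetition[OF \<G>(1)]] S_def
      using \<G>(2) by (simp add: parallel_repetition_def)
    have s1': "s\<^sub>1 xs \<in> tuples n (answers1 \<G>)" if "xs \<in> tuples n (left Q)" for xs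
      using s1 that \<G>(2) by (auto simp: parallel_repetition_def bigraph_power_def)
    have s2': "s\<^sub>2 ys \<in> tuples n (answers2 \<G>)" if "ys \<in> tuples n (right Q)" for ys
      using s2 that \<G>(2) by (auto simp: parallel_repetition_def bigraph_power_def)
    have En: "xs \<in> tuples n (left Q) \<and> ys \<in> tuples n (right Q)" if "(xs, ys) \<in> ?En" for xs ys
      using that Q finite_game_parallel_repetition[OF \<G>(1), of n] \<G>(2)
      by (auto simp: finite_game_def finite_bigraph_def parallel_repetition_def bigraph_power_def)
    \<comment> \<open>If the \<open>i\<close>-th draw is \<open>\<omega>\<^sub>0\<close>, then
      \<open>X x\<close> and \<open>Y y\<close> have \<open>x\<close> and \<open>y\<close> in
      coordinate \<open>i\<close>. Answering in the original game with the \<open>i\<close>-th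
      coordinates of the repeated strategies at \<open>X x\<close> and \<open>Y y\<close> wins on
      every edge, which contradicts non-triviality.\<close>
    have avoid: "\<omega>\<^sub>0 \<notin> set \<omega>s" if \<omega>s: "\<omega>s \<in> tuples n \<Omega>" "copy_in H \<phi> \<psi> S \<omega>s" for \<omega>s
    proof
      assume "\<omega>\<^sub>0 \<in> set \<omega>s"
      then obtain i where i: "i < n" "\<omega>s ! i = \<omega>\<^sub>0" using \<omega>s(1) by (auto simp: in_set_conv_nth tuples_def)
      have len: "length \<omega>s = n" using \<omega>s(1) by (simp add: tuples_def)
      define X where "X x = map (\<lambda>\<omega>. \<phi> \<omega> (finv x)) \<omega>s" for x
      define Y where "Y y = map (\<lambda>\<omega>. \<psi> \<omega> (ginv y)) \<omega>s" for y
      have XY: "(X x, Y y) \<in> S" if "(x, y) \<in> edges Q" for x y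
        using \<omega>s(2) inv_edge[OF that] unfolding copy_in_def X_def Y_def by blast
      \<comment> \<open>Every question lies on an edge; this makes \<open>X x\<close> a tuple of
        questions, so the answers read off from \<open>s\<^sub>1\<close> stay in the
        alphabet.\<close>
      have nio: "\<exists>y. (x, y) \<in> edges Q" if "x \<in> left Q" for x
      proof -
        obtain a where "a \<in> left H" "x = f a" using \<open>x \<in> left Q\<close> im by blast
        moreover from this obtain b where "(a, b) \<in> edges H" using wfH(3) unfolding no_isolated_vertices_def by blast
        ultimately show ?thesis unfolding E by force
      qed
      have nio': "\<exists>x. (x, y) \<in> edges Q" if "y \<in> right Q" for y
      proof -
        obtain b where "b \<in> right H" "y = g b" using \<open>y \<in> right Q\<close> im by blast
        moreover from this obtain a where "(a, b) \<in> edges H" using wfH(3) unfolding no_isolated_vertices_def by blast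
        ultimately show ?thesis unfolding E by force
      qed
      have SE: "S \<subseteq> ?En" by (auto simp: S_def)
      define t\<^sub>1 where "t\<^sub>1 = restrict (\<lambda>x. s\<^sub>1 (X x) ! i) (left Q)"
      define t\<^sub>2 where "t\<^sub>2 = restrict (\<lambda>y. s\<^sub>2 (Y y) ! i) (right Q)"
      have "s\<^sub>1 (X x) ! i \<in> answers1 \<G>" if x: "x \<in> left Q" for x
      proof -
        obtain y where "(x, y) \<in> edges Q" using nio[OF x] by blast
        then have "X x \<in> tuples n (left Q)" using XY SE En by blast
        then have "s\<^sub>1 (X x) \<in> tuples n (answers1 \<G>)" by (rule s1')
        then show ?thesis using i(1) by (auto simp: tuples_def)
      qed
      then have t1: "t\<^sub>1 \<in> left (question_set \<G>) \<rightarrow>\<^sub>E answers1 \<G>" unfolding \<G>(2) t\<^sub>1_def by auto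
      have "s\<^sub>2 (Y y) ! i \<in> answers2 \<G>" if y: "y \<in> right Q" for y
      proof -
        obtain x where "(x, y) \<in> edges Q" using nio'[OF y] by blast
        then have "Y y \<in> tuples n (right Q)" using XY SE En by blast
        then have "s\<^sub>2 (Y y) \<in> tuples n (answers2 \<G>)" by (rule s2')
        then show ?thesis using i(1) by (auto simp: tuples_def)
      qed
      then have t2: "t\<^sub>2 \<in> right (question_set \<G>) \<rightarrow>\<^sub>E answers2 \<G>" unfolding \<G>(2) t\<^sub>2_def by auto
      have "accepts \<G> (x, y) (t\<^sub>1 x) (t\<^sub>2 y)" if xy: "(x, y) \<in> edges (question_set \<G>)" for x y
      proof -
        have xy: "(x, y) \<in> edges Q" and x: "x \<in> left Q" and y: "y \<in> right Q"
          using xy \<G>(2) Q by (auto simp: finite_bigraph_def)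
        have "X x ! i = x" "Y y ! i = y"
          using finv[OF x] ginv[OF y] i len \<omega>0 by (auto simp: X_def Y_def)
        moreover have "accepts \<G> (X x ! i, Y y ! i) (s\<^sub>1 (X x) ! i) (s\<^sub>2 (Y y) ! i)"
          using XY[OF xy] i(1) by (auto simp: S_def parallel_repetition_def)
        ultimately show ?thesis using x y by (simp add: t\<^sub>1_def t\<^sub>2_def)
      qed
      then show False using trivial_game_if_perfect[OF \<G>(1) t1 t2] \<G>(3) by blast
    qed
    define \<mu> where "\<mu> = card S / card ?En"
    have "\<mu> ^ K \<le> (\<Sum>\<omega>s | \<omega>s \<in> tuples n \<Omega> \<and> copy_in H \<phi> \<psi> S \<omega>s. prod_list (map w \<omega>s))"
      unfolding \<mu>_def by (rule sampler_density[OF s]) (auto simp: S_def)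
    also have "\<dots> \<le> (\<Sum>\<omega>s\<in>tuples n (\<Omega> - {\<omega>\<^sub>0}). prod_list (map w \<omega>s))"
    proof (rule sum_mono2)
      show "finite (tuples n (\<Omega> - {\<omega>\<^sub>0}))" using fin by (simp add: finite_tuples)
      show "{\<omega>s. \<omega>s \<in> tuples n \<Omega> \<and> copy_in H \<phi> \<psi> S \<omega>s} \<subseteq> tuples n (\<Omega> - {\<omega>\<^sub>0})"
        using avoid by (auto simp: tuples_def)
    qed (use w in \<open>auto simp: tuples_def subset_iff less_imp_le intro!: prod_list_nonneg_real\<close>)
    also have "\<dots> = D ^ n" by (simp add: sum_tuples_prod_list D)
    finally have "root K (\<mu> ^ K) \<le> root K (D ^ n)" using K by simp
    then show "winning_prob ?R s\<^sub>1 s\<^sub>2 \<le> C ^ n"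
      using K by (simp add: prob \<mu>_def C_def real_root_power_cancel real_root_power)
  qed
  have "repetition_value Q n \<le> C ^ n" for n
  proof -
    let ?V = "{game_value (parallel_repetition n \<G>) | \<G> :: ('a, 'b, nat, nat) game.
            finite_game \<G> \<and> question_set \<G> = Q \<and> \<not> trivial_game \<G>}"
    \<comment> \<open>The game that always rejects shows that the supremum is over a nonempty
      set.\<close>
    define \<G> :: "('a, 'b, nat, nat) game" where
      "\<G> = \<lparr>question_set = Q, answers1 = {0}, answers2 = {0}, accepts = \<lambda>_ _ _. False\<rparr>"
    have fG: "finite_game \<G>" using Q neE by (simp add: finite_game_def \<G>_def)
    have "winning_prob \<G> s t \<le> 0" for s t
      unfolding winning_prob_eq[OF fG] by (simp add: \<G>_def)
    then have "game_value \<G> \<le> 0" using game_value_le[OF fG] by blast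
    then have "\<not> trivial_game \<G>" by (simp add: trivial_game_def)
    moreover have "question_set \<G> = Q" by (simp add: \<G>_def)
    ultimately have "?V \<noteq> {}" using fG by blast
    then show ?thesis
      unfolding repetition_value_def by (rule cSup_least) (use bound in auto)
  qed
  then show ?thesis unfolding exponential_parallel_repetition_def using C1 by blast
qed

theorem theorem1p11:
  fixes G :: "('a, 'b) bigraph"
  assumes "finite_bigraph G"
    and "bigraph_treewidth G \<le> 2"
    and "edges G \<noteq> {}"
    and "no_isolated_vertices G"
  shows "constructible_by_conditioning G \<and> exponential_parallel_repetition G"
  using constructible_if_treewidth_le_2[OF assms(1,4,3,2)]
    exponential_parallel_repetition_if_constructible[OF _ assms(1)] by blast

end
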